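(* Let $(x,\varepsilon,0,y)$ be an extended abnormal extremal tuple, let $\{b_j\}_{j\in\mathbb Z}$ be its switch points, and fix $j$. Let $\epsilon=\varepsilon(b_j+0)$ be the value of $\varepsilon(\cdot)$ in the layer $I=(b_j,b_{j+1})$. Let $q:=-\frac{\operatorname{Im}\kappa}{\operatorname{Re}\kappa}$ and $q_1:=\frac{1+e^{-q\pi}}{1-e^{-q\pi}}$ (so $q_1>1$). (i) Assume that $x[\overline I]:=\{x(s):s\in[b_j,b_{j+1}]\}$ does not intersect $\mathrm i\hat{\mathbb R}$. Then $$b_{j+1}-b_j=\frac{\pi}{2\epsilon^{1/2}\operatorname{Re}\kappa}.$$ Moreover, $x(b_{j+1})=f_{M(\epsilon)}(x(b_j))$, where $M(\epsilon):=\begin{pmatrix}1&\epsilon^{1/2}q_1\\ \epsilon^{-1/2}q_1&1\end{pmatrix}$ and, for a matrix $M=(a_{lm})_{l,m=1}^2\in\mathrm{GL}_2(\mathbb C)$, $f_M(z)=\frac{a_{11}z+a_{12}}{a_{21}z+a_{22}}$ is the associated Möbius transformation. (ii) Assume that $x(s_0)\in\{0,\infty\}$ for a certain $s_0\in[b_j,b_{j+1}]$. Then $s_0=(b_j+b_{j+1})/2$ and $$b_{j+1}-b_j=\frac{\pi}{\epsilon^{1/2}\operatorname{Re}\kappa};$$ besides, $-x(b_j)=x(b_{j+1})\in(0,\epsilon^{1/2})$ in the case $x(s_0)=\infty$, and $-x(b_j)=x(b_{j+1})\in(\epsilon^{1/2},+\infty)$ in the case $x(s_0)=0$.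
   Context: Fix constants $0<n_1<n_2$ and $\kappa\in\mathbb C$ with $\operatorname{Re}\kappa>0$, $\operatorname{Im}\kappa<0$. $\hat{\mathbb C}=\mathbb C\cup\{\infty\}$, $\mathrm i\hat{\mathbb R}=\mathrm i\mathbb R\cup\{\infty\}$, $\mathbb C_+=\{\operatorname{Im}z>0\}$. For a function $y$ put $\mathcal E(y)(s)=n_1^2+(n_2^2-n_1^2)\chi_{\mathbb C_+}(y^2(s))$. Let $y\in W^{2,\infty}_{\mathrm{loc}}(\mathbb R)$ be a nontrivial complex-valued solution on $\mathbb R$ of $-y''=\kappa^2\,y\,\mathcal E(y)$, let $\varepsilon=\mathcal E(y)$ and $x=\frac{y'}{\mathrm i\kappa y}$ ($x(s)=\infty$ where $y(s)=0$). The quantity $\operatorname{Im}(\varepsilon(s)y^2(s)+\kappa^{-2}(y'(s))^2)$ is a constant $\lambda_0$ independent of $s$. If $\lambda_0\ge0$, then $(x,\varepsilon,\lambda_0,y)$ is called an extended extremal tuple; it is abnormal if $\lambda_0=0$. The function $\varepsilon$ (after correction on a null set) is piecewise constant on bounded intervals with values $n_1^2,n_2^2$; a switch point is a point $b$ with $\varepsilon(b-0)\ne\varepsilon(b+0)$. The switch points form a strictly increasing sequence $\{b_j\}_{j\in\mathbb Z}$ with $\lim_{j\to\pm\infty}b_j=\pm\infty$. The intervals $(b_j,b_{j+1})$ are called layers. *)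

theory Defs
  imports "HOL-Analysis.Analysis"
begin

section \<open>Sobolev solutions on the real line\<close>

definition test_function :: "(real \<Rightarrow> real) \<Rightarrow> bool" where
  "test_function \<phi> \<longleftrightarrow>
     (\<forall>n s. (deriv ^^ n) \<phi> field_differentiable (at s)) \<and>
     compact (closure {s. \<phi> s \<noteq> 0})"

definition Linf_loc :: "(real \<Rightarrow> complex) \<Rightarrow> bool" where
  "Linf_loc u \<longleftrightarrow>
     u \<in> borel_measurable lborel \<and>
     (\<forall>a b. \<exists>C. AE s in lborel. s \<in> {a..b} \<longrightarrow> norm (u s) \<le> C)"

text \<open>
  Distributional derivative.  The integrals are only meaningful for locally integrable
  functions; below, \<open>u\<close> and \<open>g\<close> always satisfy \<^const>\<open>Linf_loc\<close>.  Real test functions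
  suffice by linearity.
\<close>

definition weak_deriv :: "(real \<Rightarrow> complex) \<Rightarrow> (real \<Rightarrow> complex) \<Rightarrow> bool" where
  "weak_deriv u g \<longleftrightarrow>
     (\<forall>\<phi>. test_function \<phi> \<longrightarrow>
        (LINT s|lborel. deriv \<phi> s *\<^sub>R u s) = - (LINT s|lborel. \<phi> s *\<^sub>R g s))"

text \<open>\<open>y\<close> lies in $W^{2,\infty}_{loc}$ with first and second weak derivatives \<open>y1\<close>, \<open>y2\<close>.\<close>

definition W2inf_loc ::
    "(real \<Rightarrow> complex) \<Rightarrow> (real \<Rightarrow> complex) \<Rightarrow> (real \<Rightarrow> complex) \<Rightarrow> bool" where
  "W2inf_loc y y1 y2 \<longleftrightarrow>
     Linf_loc y \<and> Linf_loc y1 \<and> Linf_loc y2 \<and> weak_deriv y y1 \<and> weak_deriv y1 y2"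

text \<open>
  A class in $W^{2,\infty}_{loc}$ has exactly one $C^1$ representative.  Point values of \<open>y\<close> and
  \<open>y'\<close> are those of this representative; its classical derivative is
  \<open>vector_derivative y (at s)\<close> (\<^const>\<open>deriv\<close> does not apply to functions from the reals to the
  complex numbers).
\<close>

abbreviation dy :: "(real \<Rightarrow> complex) \<Rightarrow> real \<Rightarrow> complex" where
  "dy y s \<equiv> vector_derivative y (at s)"

definition C1_fun :: "(real \<Rightarrow> complex) \<Rightarrow> bool" where
  "C1_fun y \<longleftrightarrow> (\<forall>s. y differentiable (at s)) \<and> continuous_on UNIV (dy y)"

definition permittivity :: "real \<Rightarrow> real \<Rightarrow> (real \<Rightarrow> complex) \<Rightarrow> real \<Rightarrow> real" where
  "permittivity n1 n2 y s =
     n1\<^sup>2 + (n2\<^sup>2 - n1\<^sup>2) * indicator {z. Im z > 0} ((y s)\<^sup>2)"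

definition nontrivial_solution ::
    "real \<Rightarrow> real \<Rightarrow> complex \<Rightarrow> (real \<Rightarrow> complex) \<Rightarrow> bool" where
  "nontrivial_solution n1 n2 \<kappa> y \<longleftrightarrow>
     C1_fun y \<and> (\<exists>s. y s \<noteq> 0) \<and>
     (\<exists>y1 y2. W2inf_loc y y1 y2 \<and>
        (AE s in lborel. - y2 s = \<kappa>\<^sup>2 * y s * of_real (permittivity n1 n2 y s)))"


section \<open>Riemann sphere\<close>

datatype csphere = Fin complex | Infty

definition imaginary_circle :: "csphere set" where
  "imaginary_circle = insert Infty (Fin ` {z. Re z = 0})"

fun moebius_map :: "complex^2^2 \<Rightarrow> csphere \<Rightarrow> csphere" where
  "moebius_map M (Fin z) =
     (if M$2$1 * z + M$2$2 = 0 then Infty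
      else Fin ((M$1$1 * z + M$1$2) / (M$2$1 * z + M$2$2)))"
| "moebius_map M Infty = (if M$2$1 = 0 then Infty else Fin (M$1$1 / M$2$1))"


section \<open>Extended extremal tuples\<close>

definition extended_extremal_tuple ::
    "real \<Rightarrow> real \<Rightarrow> complex \<Rightarrow>
     (real \<Rightarrow> csphere) \<Rightarrow> (real \<Rightarrow> real) \<Rightarrow> real \<Rightarrow> (real \<Rightarrow> complex) \<Rightarrow> bool" where
  "extended_extremal_tuple n1 n2 \<kappa> x eps lam y \<longleftrightarrow>
     nontrivial_solution n1 n2 \<kappa> y \<and>
     (\<forall>s. eps s = permittivity n1 n2 y s) \<and>
     (\<forall>s. x s = (if y s = 0 then Infty else Fin (dy y s / (\<i> * \<kappa> * y s)))) \<and>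
     (\<forall>s. Im (of_real (eps s) * (y s)\<^sup>2 + (dy y s)\<^sup>2 / \<kappa>\<^sup>2) = lam) \<and>
     0 \<le> lam"

definition abnormal_extremal_tuple ::
    "real \<Rightarrow> real \<Rightarrow> complex \<Rightarrow>
     (real \<Rightarrow> csphere) \<Rightarrow> (real \<Rightarrow> real) \<Rightarrow> real \<Rightarrow> (real \<Rightarrow> complex) \<Rightarrow> bool" where
  "abnormal_extremal_tuple n1 n2 \<kappa> x eps lam y \<longleftrightarrow>
     extended_extremal_tuple n1 n2 \<kappa> x eps lam y \<and> lam = 0"

text \<open>
  No correction of \<open>eps\<close> on a null set is needed here: the one-sided limits below are taken over
  punctured one-sided neighbourhoods, and the points where the pointwise defined \<open>eps\<close> differs from
  its piecewise constant version are isolated (\<open>(y s)\<^sup>2\<close> then touches the real line without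
  crossing it, or \<open>s\<close> is itself a switch point).
\<close>

definition switch_points :: "(real \<Rightarrow> real) \<Rightarrow> real set" where
  "switch_points eps =
     {b. \<exists>l r. (eps \<longlongrightarrow> l) (at_left b) \<and> (eps \<longlongrightarrow> r) (at_right b) \<and> l \<noteq> r}"

definition enumerates_switch_points :: "(real \<Rightarrow> real) \<Rightarrow> (int \<Rightarrow> real) \<Rightarrow> bool" where
  "enumerates_switch_points eps b \<longleftrightarrow>
     strict_mono b \<and> range b = switch_points eps \<and>
     filterlim b at_top at_top \<and> filterlim b at_bot at_bot"

definition q_of :: "complex \<Rightarrow> real" where
  "q_of \<kappa> = - (Im \<kappa> / Re \<kappa>)"

definition q1_of :: "complex \<Rightarrow> real" where
  "q1_of \<kappa> = (1 + exp (- q_of \<kappa> * pi)) / (1 - exp (- q_of \<kappa> * pi))"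

definition layer_matrix :: "complex \<Rightarrow> real \<Rightarrow> complex^2^2" where
  "layer_matrix \<kappa> e =
     vector [vector [1, of_real (sqrt e * q1_of \<kappa>)],
             vector [of_real (q1_of \<kappa> / sqrt e), 1]]"

end

theory Submission
  imports Defs
begin

text \<open>
  Write \<open>p = y' / \<kappa>\<close>.  In the abnormal case \<open>Im (\<epsilon> y\<^sup>2 + p\<^sup>2) = 0\<close>, so \<open>y\<^sup>2\<close> and \<open>p\<^sup>2\<close> become real at
  the same points.  At such a point the derivative \<open>2 Im (\<kappa> y p)\<close> of \<open>Im (y\<^sup>2)\<close> can vanish only if
  \<open>y = 0\<close> or \<open>p = 0\<close>, because otherwise \<open>y p\<close> is a nonzero real or imaginary number and \<open>\<kappa>\<close> is
  neither.  If \<open>y = 0\<close> or \<open>p = 0\<close>, then \<open>y\<^sup>2\<close> touches the real axis without crossing, since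
  \<open>\<kappa>\<^sup>2\<close> is not real.  Hence the switch points are exactly the points where \<open>y\<^sup>2\<close> is real
  and \<open>x \<notin> {0, \<infinity>}\<close> (\<open>switch_points_iff\<close>).

  In a layer \<open>\<epsilon>\<close> is constant off isolated points, and with \<open>r = \<epsilon>\<^sup>1\<^sup>/\<^sup>2\<close> the solution is a sum of
  two waves, \<open>y = F + H\<close> and \<open>p = \<i> r (F - H)\<close>, where \<open>F\<close> turns by the angle \<open>u = r s Re \<kappa>\<close> over
  a distance \<open>s\<close> while its modulus grows by \<open>exp (q u)\<close>, and \<open>H\<close> behaves inversely.  The conserved
  quantity says that \<open>F H\<close> is real.  Therefore, measured from a point where \<open>F\<^sup>2\<close> and
  \<open>H\<^sup>2\<close> are real with values \<open>f\<close> and \<open>h\<close>,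
  \<open>Im (y\<^sup>2) = sin (2 u) (f exp (2 q u) - h exp (- 2 q u))\<close> (\<open>Im_y_square\<close>).
  The second factor vanishes only where \<open>F\<close> and \<open>H\<close> have equal moduli, which forces
  \<open>x = r (F - H) / (F + H)\<close> onto the imaginary circle.

  In the first case this is excluded, the left end of the layer can be taken as the origin, and the
  next switch point comes at \<open>u = \<pi> / 2\<close>; there \<open>F / H\<close> has been multiplied by \<open>- exp (q \<pi>)\<close>, which
  in terms of \<open>x\<close> is the stated Moebius map (\<open>full_quarter\<close>, \<open>ratio_after_quarter\<close>).  In the second
  case the point \<open>s0\<close> itself can be taken as the origin, with \<open>f = h\<close>; it is not a switch point,
  and the nearest ones are at \<open>u = \<pi> / 2\<close> and \<open>u = - \<pi> / 2\<close> (\<open>centred_layer\<close>).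

  These arguments need the equation in integrated form, which has to be derived from the
  distributional one (\<open>W2inf_loc_second_deriv_integral\<close>), and unique continuation
  (\<open>no_double_zero\<close>).
\<close>

section \<open>A smooth step function\<close>

text \<open>
  For polynomials \<open>p\<close>, these functions contain the standard bump \<open>exp (- 1 / (x (1 - x)))\<close> and
  form a family closed under differentiation, so that smoothness of the bump follows from one
  derivative computation.
\<close>

definition flat_bump :: "real poly \<Rightarrow> nat \<Rightarrow> real \<Rightarrow> real" where
  "flat_bump p n x =
     (if 0 < x \<and> x < 1 then poly p x * inverse (x * (1 - x)) ^ n * exp (- inverse (x * (1 - x))) else 0)"

lemma exp_minus_inverse_le:
  fixes w :: real
  assumes "0 < w"
  shows "exp (- inverse w) \<le> fact k * w ^ k"
proof -
  have "(inverse w) ^ k / fact k \<le> exp (inverse w)"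
  proof -
    have sums: "(\<lambda>n. inverse w ^ n / fact n) sums exp (inverse w)"
      using exp_converges[of "inverse w"] by (simp add: divide_inverse mult.commute)
    have "(\<Sum>n\<in>{k}. inverse w ^ n / fact n) \<le> (\<Sum>n. inverse w ^ n / fact n)"
      using assms sums_summable[OF sums] by (intro sum_le_suminf) auto
    then show ?thesis using sums by (simp add: sums_unique[symmetric])
  qed
  then show ?thesis
    using assms by (simp add: exp_minus field_simps power_inverse)
qed

text \<open>
  The exponential beats every power of \<open>x (1 - x)\<close>, and this weight is at most the distance
  from \<open>x\<close> to any point outside the open unit interval.  The quadratic bound makes the derivative
  vanish at all such points, the two ends of the support included.
\<close>

lemma flat_bump_quadratic_bound:
  "\<exists>C. \<forall>x c. \<not> (0 < c \<and> c < 1) \<longrightarrow> \<bar>flat_bump p n x\<bar> \<le> C * (x - c)\<^sup>2"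
proof -
  have "compact (poly p ` {0..1})"
    by (intro compact_continuous_image continuous_intros) auto
  then obtain B where B: "\<And>x. x \<in> {0..1} \<Longrightarrow> \<bar>poly p x\<bar> \<le> B"
    by (metis compact_imp_bounded bounded_iff imageI real_norm_def)
  have B0: "0 \<le> B" using B[of 0] by auto
  have "\<bar>flat_bump p n x\<bar> \<le> B * fact (n + 2) * (x - c)\<^sup>2" if c: "\<not> (0 < c \<and> c < 1)" for x c
  proof (cases "0 < x \<and> x < 1")
    case True
    define w where "w = x * (1 - x)"
    have w: "0 < w" "w \<le> x" "w \<le> 1 - x"
      using True by (auto simp: w_def mult_left_le mult_left_le_one_le)
    then have wc: "w \<le> \<bar>x - c\<bar>" using c True by (auto simp: abs_if)
    have "\<bar>flat_bump p n x\<bar> = \<bar>poly p x\<bar> / w ^ n * exp (- inverse w)"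
      using True w by (simp add: flat_bump_def w_def[symmetric] abs_mult power_inverse divide_inverse del: inverse_mult_distrib)
    also have "\<dots> \<le> B / w ^ n * (fact (n + 2) * w ^ (n + 2))"
      using w True B[of x] B0 by (intro mult_mono divide_right_mono exp_minus_inverse_le) auto
    also have "\<dots> = B * fact (n + 2) * w\<^sup>2"
      using w by (simp add: power_add field_simps power2_eq_square del: fact_Suc)
    also have "\<dots> \<le> B * fact (n + 2) * \<bar>x - c\<bar>\<^sup>2"
      using w wc B0 by (intro mult_left_mono power_mono) auto
    finally show ?thesis by simp
  next
    case False
    then show ?thesis using B0 unfolding flat_bump_def by (simp only: if_not_P) simp
  qed
  then show ?thesis by blast
qed

lemma flat_bump_has_derivative:
  "(flat_bump p n has_real_derivative
     flat_bump (pderiv p * [:0, 1, -1:]\<^sup>2 - smult (of_nat n) (p * [:1, -2:] * [:0, 1, -1:])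
                + p * [:1, -2:]) (n + 2) c) (at c)"
proof (cases "0 < c \<and> c < 1")
  case True
  then have w: "c * (1 - c) \<noteq> 0" by auto
  have "((\<lambda>x. poly p x * inverse (x * (1 - x)) ^ n * exp (- inverse (x * (1 - x))))
      has_real_derivative
     flat_bump (pderiv p * [:0, 1, -1:]\<^sup>2 - smult (of_nat n) (p * [:1, -2:] * [:0, 1, -1:])
                + p * [:1, -2:]) (n + 2) c) (at c)"
  proof -
    define w where "w = (\<lambda>x::real. x * (1 - x))"
    define v where "v = inverse (w c)"
    have w0: "w c \<noteq> 0" using True by (simp add: w_def)
    have wv: "w c * v = 1" using w0 by (simp add: v_def)
    have dw: "(w has_real_derivative (1 - 2 * c)) (at c)"
      unfolding w_def by (auto intro!: derivative_eq_intros)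
    have "((\<lambda>x. poly p x * inverse (w x) ^ n * exp (- inverse (w x))) has_real_derivative
        (poly (pderiv p) c * v ^ n + poly p c * (of_nat n * v ^ (n - 1) * (- (1 - 2 * c) * v\<^sup>2))
          + poly p c * v ^ n * ((1 - 2 * c) * v\<^sup>2)) * exp (- v)) (at c)"
      by (rule derivative_eq_intros refl poly_DERIV dw w0)+
        (simp add: v_def algebra_simps power2_eq_square)
    moreover have "(poly (pderiv p) c * v ^ n + poly p c * (of_nat n * v ^ (n - 1) * (- (1 - 2 * c) * v\<^sup>2))
          + poly p c * v ^ n * ((1 - 2 * c) * v\<^sup>2))
        = (poly (pderiv p) c * (w c)\<^sup>2 - of_nat n * (poly p c * (1 - 2 * c) * w c)
          + poly p c * (1 - 2 * c)) * v ^ (n + 2)" (is "?L = ?R")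
    proof -
      have k1: "of_nat n * v ^ (n - 1) * v\<^sup>2 = of_nat n * (w c * v ^ (n + 2))"
      proof -
        have "w c * v ^ (n + 2) = (w c * v) * v ^ (n + 1)" by simp
        also have "\<dots> = v ^ (n + 1)" by (simp only: wv mult_1_left)
        finally have "w c * v ^ (n + 2) = v ^ (n + 1)" .
        moreover have "of_nat n * v ^ (n - 1) * v\<^sup>2 = of_nat n * v ^ (n + 1)"
          by (cases n) (simp_all add: power2_eq_square)
        ultimately show ?thesis by (simp only:)
      qed
      have k2: "v ^ n = (w c)\<^sup>2 * v ^ (n + 2)"
      proof -
        have "(w c)\<^sup>2 * v ^ (n + 2) = (w c * v)\<^sup>2 * v ^ n" by (simp add: power_add power_mult_distrib power2_eq_square)
        then show ?thesis unfolding wv by simp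
      qed
      have "?L = poly (pderiv p) c * v ^ n - poly p c * (1 - 2 * c) * (of_nat n * v ^ (n - 1) * v\<^sup>2)
          + poly p c * (1 - 2 * c) * v ^ (n + 2)"
        by (simp add: algebra_simps power_add power2_eq_square)
      also have "\<dots> = ?R" unfolding k1 by (subst k2) (simp add: algebra_simps)
      finally show ?thesis .
    qed
    ultimately have "((\<lambda>x. poly p x * inverse (w x) ^ n * exp (- inverse (w x))) has_real_derivative
        ((poly (pderiv p) c * (w c)\<^sup>2 - of_nat n * (poly p c * (1 - 2 * c) * w c)
          + poly p c * (1 - 2 * c)) * v ^ (n + 2)) * exp (- v)) (at c)"
      by simp
    then show ?thesis
      using True by (simp add: flat_bump_def w_def v_def algebra_simps)
  qed
  then show ?thesis
    by (rule has_field_derivative_transform_within_open[where S="{0<..<1}"])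
      (use True in \<open>auto simp: flat_bump_def\<close>)
next
  case False
  obtain C where C: "\<And>x. \<bar>flat_bump p n x\<bar> \<le> C * (x - c)\<^sup>2"
    using flat_bump_quadratic_bound[of p n] False by blast
  have zero: "flat_bump q m c = 0" for q m using False by (auto simp: flat_bump_def)
  have "((\<lambda>x. (flat_bump p n x - flat_bump p n c) / (x - c)) \<longlongrightarrow> 0) (at c)"
  proof (rule Lim_null_comparison)
    show "\<forall>\<^sub>F x in at c. norm ((flat_bump p n x - flat_bump p n c) / (x - c)) \<le> C * \<bar>x - c\<bar>"
    proof (intro always_eventually allI)
      fix x
      show "norm ((flat_bump p n x - flat_bump p n c) / (x - c)) \<le> C * \<bar>x - c\<bar>"
      proof (cases "x = c")
        case False
        then show ?thesis using C[of x] zero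
          by (simp add: abs_divide divide_le_eq power2_eq_square abs_mult mult.assoc)
      qed simp
    qed
    show "((\<lambda>x. C * \<bar>x - c\<bar>) \<longlongrightarrow> 0) (at c)"
      by (auto intro!: tendsto_eq_intros)
  qed
  then show ?thesis by (simp add: has_field_derivative_iff zero)
qed

text \<open>
  A coinduction principle for smoothness: it suffices to exhibit a set of functions that contains
  the derivatives of its members.
\<close>

lemma derivative_closed_imp_smooth:
  fixes f :: "real \<Rightarrow> real"
  assumes "f \<in> A" and closed: "\<And>g. g \<in> A \<Longrightarrow> \<exists>g'\<in>A. \<forall>x. (g has_real_derivative g' x) (at x)"
  shows "(deriv ^^ n) f field_differentiable (at s)"
proof -
  have "(deriv ^^ n) f \<in> A"
  proof (induction n)
    case (Suc n)
    obtain g' where g': "g' \<in> A" "\<forall>x. ((deriv ^^ n) f has_real_derivative g' x) (at x)"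
      using closed[OF Suc] by blast
    then have "deriv ((deriv ^^ n) f) = g'" by (intro ext DERIV_imp_deriv) auto
    then show ?case using g' by simp
  qed (use assms in simp)
  then show ?thesis using closed field_differentiable_def by blast
qed

text \<open>
  The antiderivative of the normalised bump.  The derivative-closed set \<open>A\<close> is kept in the
  statement because the test functions built below by rescaling inherit their smoothness from it.
\<close>

lemma smooth_step_exists:
  obtains S \<rho> :: "real \<Rightarrow> real" and A where
    "S \<in> A" "\<rho> \<in> A" "\<And>g. g \<in> A \<Longrightarrow> \<exists>g'\<in>A. \<forall>x. (g has_real_derivative g' x) (at x)"
    "\<And>x. (S has_real_derivative \<rho> x) (at x)"
    "\<And>x. x \<le> 0 \<Longrightarrow> S x = 0" "\<And>x. 1 \<le> x \<Longrightarrow> S x = 1" "\<And>x. 0 \<le> S x \<and> S x \<le> 1"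
    "\<And>x. x \<notin> {0..1} \<Longrightarrow> \<rho> x = 0" 
proof -
  define \<rho>0 where "\<rho>0 = flat_bump 1 0"
  have der: "\<exists>g'. (\<forall>x. (flat_bump p n has_real_derivative g' x) (at x)) \<and> g' \<in> range (case_prod flat_bump)" for p n
    using flat_bump_has_derivative[of p n] by (metis (no_types, lifting) case_prod_conv rangeI)
  have cont: "isCont \<rho>0 x" for x
    unfolding \<rho>0_def using flat_bump_has_derivative DERIV_isCont by blast
  obtain S0 where S0: "\<And>x. (S0 has_real_derivative \<rho>0 x) (at x)"
    using einterval_antiderivative[of "-\<infinity>" \<infinity> \<rho>0] cont
    by (auto simp: has_real_derivative_iff_has_vector_derivative)
  have nonneg: "0 \<le> \<rho>0 x" for x by (auto simp: \<rho>0_def flat_bump_def)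
  have out: "\<rho>0 x = 0" if "\<not> (0 < x \<and> x < 1)" for x using that by (auto simp: \<rho>0_def flat_bump_def)
  have pos: "0 < \<rho>0 x" if "0 < x" "x < 1" for x using that by (auto simp: \<rho>0_def flat_bump_def)
  have mono: "S0 x \<le> S0 y" if "x \<le> y" for x y
    using DERIV_nonneg_imp_nondecreasing[OF that, of S0] S0 nonneg by blast
  have left: "S0 x = S0 0" if "x \<le> 0" for x
  proof -
    have "\<exists>y. (S0 has_real_derivative y) (at z) \<and> y \<le> 0" if "z \<le> 0" for z
      using S0[of z] out[of z] that by auto
    then have "S0 x \<ge> S0 0" using DERIV_nonpos_imp_nonincreasing[of x 0 S0] that by blast
    then show ?thesis using mono[OF that] by simp
  qed
  have right: "S0 x = S0 1" if "1 \<le> x" for x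
  proof -
    have "\<exists>y. (S0 has_real_derivative y) (at z) \<and> y \<le> 0" if "1 \<le> z" for z
      using S0[of z] out[of z] that by auto
    then have "S0 x \<le> S0 1" using DERIV_nonpos_imp_nonincreasing[of 1 x S0] that by blast
    then show ?thesis using mono[OF that] by simp
  qed
  have less: "S0 0 < S0 1"
  proof (rule DERIV_pos_imp_increasing_open[of 0 1 S0])
    show "\<exists>y. (S0 has_real_derivative y) (at x) \<and> 0 < y" if "0 < x" "x < 1" for x
      using S0 pos that by blast
    show "continuous_on {0..1} S0"
      using S0 by (meson DERIV_isCont continuous_at_imp_continuous_on)
  qed auto
  define c where "c = S0 1 - S0 0"
  have c: "0 < c" using less by (simp add: c_def)
  define S where "S = (\<lambda>x. (S0 x - S0 0) / c)"
  define A where "A = insert S {\<lambda>x. flat_bump p n x / c |p n. True}"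
  have dS: "(S has_real_derivative \<rho>0 x / c) (at x)" for x
    unfolding S_def using c by (auto intro!: derivative_eq_intros S0)
  have rA: "(\<lambda>x. \<rho>0 x / c) \<in> A" unfolding A_def \<rho>0_def by auto
  show thesis
  proof (rule that[of S A "\<lambda>x. \<rho>0 x / c"])
    show "\<exists>g'\<in>A. \<forall>x. (g has_real_derivative g' x) (at x)" if gA: "g \<in> A" for g
    proof (cases "g = S")
      case True
      then show ?thesis using dS by (intro bexI[OF _ rA]) simp
    next
      case False
      then obtain p n where g: "g = (\<lambda>x. flat_bump p n x / c)" using gA by (auto simp: A_def)
      obtain p' n' where d: "\<And>x. (flat_bump p n has_real_derivative flat_bump p' n' x) (at x)"
        using flat_bump_has_derivative by blast
      have "(\<lambda>x. flat_bump p' n' x / c) \<in> A" by (auto simp: A_def)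
      moreover have "(g has_real_derivative flat_bump p' n' x / c) (at x)" for x
        unfolding g using DERIV_cdivide[OF d] .
      ultimately show ?thesis by (intro bexI[where x="\<lambda>x. flat_bump p' n' x / c"]) auto
    qed
    show "S x = 0" if "x \<le> 0" for x using left[OF that] by (simp add: S_def)
    show "S x = 1" if "1 \<le> x" for x using right[OF that] c by (simp add: S_def c_def)
    show "0 \<le> S x \<and> S x \<le> 1" for x
    proof -
      have "S0 0 \<le> S0 x" "S0 x \<le> S0 1"
        using left[of x] right[of x] mono[of 0 x] mono[of x 1] mono[of 0 1] by (cases "x \<le> 0"; cases "1 \<le> x"; simp)+
      then show ?thesis using c by (simp add: S_def c_def)
    qed
    show "\<rho>0 x / c = 0" if "x \<notin> {0..1}" for x using out[of x] that by auto
  qed (use dS rA in \<open>auto simp: A_def\<close>)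
qed

section \<open>From the weak to the integrated equation\<close>

lemma C1_funD:
  assumes "C1_fun y"
  shows "(y has_vector_derivative dy y s) (at s)" "continuous_on UNIV y" "continuous_on UNIV (dy y)"
proof -
  show "(y has_vector_derivative dy y s) (at s)" for s
    using assms by (simp add: C1_fun_def vector_derivative_works[symmetric])
  then show "continuous_on UNIV y"
    by (meson continuous_at_imp_continuous_on has_vector_derivative_continuous)
  show "continuous_on UNIV (dy y)" using assms by (simp add: C1_fun_def)
qed

text \<open>
  Against test functions, a weak derivative of a \<open>C\<^sup>1\<close> function cannot be told apart from the
  classical one: both arise from the same integration by parts.
\<close>

lemma C1_weak_deriv:
  assumes y: "C1_fun y" and w: "weak_deriv y g" and \<phi>: "test_function \<phi>"
  shows "(LINT s|lborel. \<phi> s *\<^sub>R g s) = (LINT s|lborel. \<phi> s *\<^sub>R dy y s)"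
proof -
  have diff: "(\<phi> has_real_derivative deriv \<phi> s) (at s)" for s
    using \<phi> unfolding test_function_def
    by (metis DERIV_deriv_iff_field_differentiable funpow_0)
  have diff2: "isCont (deriv \<phi>) s" for s
    using \<phi> unfolding test_function_def
    by (metis field_differentiable_imp_continuous_at funpow_simps_right(2) funpow_0 funpow.simps(2) comp_apply)
  obtain M0 where M0: "closure {s. \<phi> s \<noteq> 0} \<subseteq> {-M0..M0}"
    using \<phi> unfolding test_function_def
    by (metis compact_imp_bounded bounded_subset_cbox_symmetric cbox_interval)
  define M where "M = \<bar>M0\<bar> + 1"
  have out: "\<phi> s = 0" if "s \<notin> {-M<..<M}" for s
    using that M0 closure_subset[of "{s. \<phi> s \<noteq> 0}"] unfolding M_def by force
  have out': "deriv \<phi> s = 0" if "s \<notin> {-M..M}" for s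
  proof -
    have "((\<lambda>_. 0) has_real_derivative deriv \<phi> s) (at s)"
      by (rule has_field_derivative_transform_within_open[OF diff, where S="- {-M..M}"])
        (use that out in auto)
    then show ?thesis by (metis DERIV_const DERIV_unique)
  qed
  have int1: "integrable lborel (\<lambda>s. deriv \<phi> s *\<^sub>R y s)" and int2: "integrable lborel (\<lambda>s. \<phi> s *\<^sub>R dy y s)"
  proof -
    have c1: "continuous_on {-M..M} (\<lambda>s. deriv \<phi> s *\<^sub>R y s)"
      using diff2 C1_funD(2)[OF y]
      by (intro continuous_intros) (auto intro: continuous_on_subset continuous_at_imp_continuous_on)
    have c2: "continuous_on {-M..M} (\<lambda>s. \<phi> s *\<^sub>R dy y s)"
      using DERIV_isCont[OF diff] C1_funD(3)[OF y]
      by (intro continuous_intros) (auto intro: continuous_on_subset continuous_at_imp_continuous_on)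
    have "integrable lborel (\<lambda>s. indicator {-M..M} s *\<^sub>R (deriv \<phi> s *\<^sub>R y s))"
      using borel_integrable_atLeastAtMost'[OF c1] by (simp add: set_integrable_def)
    moreover have "(\<lambda>s. indicator {-M..M} s *\<^sub>R (deriv \<phi> s *\<^sub>R y s)) = (\<lambda>s. deriv \<phi> s *\<^sub>R y s)"
      using out' by (auto simp: fun_eq_iff indicator_def)
    ultimately show "integrable lborel (\<lambda>s. deriv \<phi> s *\<^sub>R y s)" by simp
    have "integrable lborel (\<lambda>s. indicator {-M..M} s *\<^sub>R (\<phi> s *\<^sub>R dy y s))"
      using borel_integrable_atLeastAtMost'[OF c2] by (simp add: set_integrable_def)
    moreover have "(\<lambda>s. indicator {-M..M} s *\<^sub>R (\<phi> s *\<^sub>R dy y s)) = (\<lambda>s. \<phi> s *\<^sub>R dy y s)"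
    proof
      show "indicator {-M..M} s *\<^sub>R (\<phi> s *\<^sub>R dy y s) = \<phi> s *\<^sub>R dy y s" for s
        using out[of s] by (cases "s \<in> {-M..M}") auto
    qed
    ultimately show "integrable lborel (\<lambda>s. \<phi> s *\<^sub>R dy y s)" by simp
  qed
  have "integral\<^sup>L lborel (\<lambda>x. indicator {-M..M} x *\<^sub>R (\<phi> x *\<^sub>R dy y x + deriv \<phi> x *\<^sub>R y x))
      = \<phi> M *\<^sub>R y M - \<phi> (-M) *\<^sub>R y (-M)"
  proof (rule integral_FTC_atLeastAtMost)
    show "((\<lambda>s. \<phi> s *\<^sub>R y s) has_vector_derivative \<phi> x *\<^sub>R dy y x + deriv \<phi> x *\<^sub>R y x) (at x within {-M..M})" for x
      using has_vector_derivative_scaleR[OF diff C1_funD(1)[OF y]]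
      by (rule has_vector_derivative_at_within)
    show "continuous_on {-M..M} (\<lambda>x. \<phi> x *\<^sub>R dy y x + deriv \<phi> x *\<^sub>R y x)"
      using DERIV_isCont[OF diff] diff2 C1_funD(2,3)[OF y]
      by (intro continuous_intros) (auto intro: continuous_on_subset continuous_at_imp_continuous_on)
  qed (simp add: M_def)
  also have "\<dots> = 0" using out by simp
  also have "(\<lambda>x. indicator {-M..M} x *\<^sub>R (\<phi> x *\<^sub>R dy y x + deriv \<phi> x *\<^sub>R y x))
      = (\<lambda>x. \<phi> x *\<^sub>R dy y x + deriv \<phi> x *\<^sub>R y x)"
  proof
    show "indicator {-M..M} x *\<^sub>R (\<phi> x *\<^sub>R dy y x + deriv \<phi> x *\<^sub>R y x)
        = \<phi> x *\<^sub>R dy y x + deriv \<phi> x *\<^sub>R y x" for x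
      using out[of x] out'[of x] by (cases "x \<in> {-M..M}") auto
  qed
  finally have "(LINT s|lborel. \<phi> s *\<^sub>R dy y s) + (LINT s|lborel. deriv \<phi> s *\<^sub>R y s) = 0"
    using int1 int2 by simp
  moreover have "(LINT s|lborel. deriv \<phi> s *\<^sub>R y s) = - (LINT s|lborel. \<phi> s *\<^sub>R g s)"
    using w \<phi> by (auto simp: weak_deriv_def)
  ultimately show ?thesis by simp
qed

text \<open>
  The rescaled kernels concentrate at \<open>a\<close>; the substitution \<open>s = a + t / (n + 1)\<close> moves the scaling
  into the argument of the continuous function \<open>u\<close>.
\<close>

lemma mollified_value_tendsto:
  fixes u :: "real \<Rightarrow> complex" and \<rho> :: "real \<Rightarrow> real"
  assumes u: "continuous_on UNIV u" and \<rho>: "continuous_on UNIV \<rho>" "\<And>x. x \<notin> {0..1} \<Longrightarrow> \<rho> x = 0"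
  shows "(\<lambda>n. LINT s|lborel. (real (Suc n) * \<rho> (real (Suc n) * (s - a))) *\<^sub>R u s)
           \<longlonglongrightarrow> (LINT s|lborel. \<rho> s *\<^sub>R u a)"
proof -
  have "(LINT s|lborel. (real (Suc n) * \<rho> (real (Suc n) * (s - a))) *\<^sub>R u s)
      = (LINT t|lborel. \<rho> t *\<^sub>R u (a + t / real (Suc n)))" for n
    using lborel_integral_real_affine[of "1 / real (Suc n)"
        "\<lambda>s. (real (Suc n) * \<rho> (real (Suc n) * (s - a))) *\<^sub>R u s" a]
    by (simp flip: integral_scaleR_right)
  moreover have "(\<lambda>n. LINT t|lborel. \<rho> t *\<^sub>R u (a + t / real (Suc n))) \<longlonglongrightarrow> (LINT s|lborel. \<rho> s *\<^sub>R u a)"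
  proof -
    have [measurable]: "u \<in> borel_measurable borel" "\<rho> \<in> borel_measurable borel"
      using u \<rho>(1) by (auto intro: borel_measurable_continuous_onI)
    have "compact (u ` {a..a+1})"
      by (intro compact_continuous_image continuous_on_subset[OF u]) auto
    then obtain B where B: "\<And>x. x \<in> {a..a+1} \<Longrightarrow> norm (u x) \<le> B"
      by (metis compact_imp_bounded bounded_iff imageI)
    show ?thesis
    proof (rule integral_dominated_convergence[where w="\<lambda>t. indicator {0..1} t *\<^sub>R (\<bar>\<rho> t\<bar> * B)"])
      have "continuous_on {0..1} (\<lambda>t. \<bar>\<rho> t\<bar> * B)"
        by (intro continuous_intros continuous_on_subset[OF \<rho>(1)]) auto
      from borel_integrable_atLeastAtMost'[OF this]
      show "integrable lborel (\<lambda>t. indicator {0..1} t *\<^sub>R (\<bar>\<rho> t\<bar> * B))"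
        by (simp add: set_integrable_def)
      show "AE t in lborel. (\<lambda>n. \<rho> t *\<^sub>R u (a + t / real (Suc n))) \<longlonglongrightarrow> \<rho> t *\<^sub>R u a"
      proof (intro AE_I2 tendsto_intros)
        fix t :: real
        have "(\<lambda>n. a + t / real (Suc n)) \<longlonglongrightarrow> a + 0"
          by (intro tendsto_intros LIMSEQ_Suc[OF lim_const_over_n])
        then show "(\<lambda>n. u (a + t / real (Suc n))) \<longlonglongrightarrow> u a"
          using u by (intro isCont_tendsto_compose[of a u]) (auto simp: continuous_on_eq_continuous_at)
      qed
      show "AE t in lborel. norm (\<rho> t *\<^sub>R u (a + t / real (Suc n))) \<le> indicator {0..1} t *\<^sub>R (\<bar>\<rho> t\<bar> * B)" for n
      proof (intro AE_I2)
        fix t :: real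
        show "norm (\<rho> t *\<^sub>R u (a + t / real (Suc n))) \<le> indicator {0..1} t *\<^sub>R (\<bar>\<rho> t\<bar> * B)"
        proof (cases "t \<in> {0..1}")
          case True
          then have "0 \<le> t / real (Suc n)" "t / real (Suc n) \<le> 1"
            by (auto simp: divide_le_eq)
          then have "a + t / real (Suc n) \<in> {a..a+1}" by auto
          from B[OF this] show ?thesis using True by (simp add: mult_left_mono)
        qed (use \<rho>(2) in simp)
      qed
    qed measurable
  qed
  ultimately show ?thesis by simp
qed

text \<open>
  The fundamental theorem of calculus for the weak second derivative.  The weak identity is tested
  with the plateau \<open>S (k (s - a)) - S (k (s - b))\<close>.  As \<open>k\<close> grows, the plateau tends to the
  indicator of \<open>(a, b]\<close>, while its derivative is a difference of two concentrating kernels and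
  picks out the values of the first derivative at \<open>a\<close> and \<open>b\<close>.
\<close>

lemma W2inf_loc_second_deriv_integral:
  assumes y: "C1_fun y" and w: "W2inf_loc y y1 y2" and "a < b"
  shows "(LINT s:{a..b}|lborel. y2 s) = dy y b - dy y a"
proof -
  obtain S \<rho> :: "real \<Rightarrow> real" and A where S: "S \<in> A" "\<rho> \<in> A"
    and A: "\<And>g. g \<in> A \<Longrightarrow> \<exists>g'\<in>A. \<forall>x. (g has_real_derivative g' x) (at x)"
    and dS: "\<And>x. (S has_real_derivative \<rho> x) (at x)"
    and S0: "\<And>x. x \<le> 0 \<Longrightarrow> S x = 0" and S1: "\<And>x. 1 \<le> x \<Longrightarrow> S x = 1"
    and S01: "\<And>x. 0 \<le> S x \<and> S x \<le> 1" and \<rho>0: "\<And>x. x \<notin> {0..1} \<Longrightarrow> \<rho> x = 0"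
    using smooth_step_exists by metis
  define T where "T k f = (\<lambda>x::real. f (k * (x - a)) - f (k * (x - b)) :: real)" for k :: real and f
  have dT: "(T k f has_real_derivative T k (\<lambda>x. k * f' x) x) (at x)"
    if f: "\<And>x. (f has_real_derivative f' x) (at x)" for f f' k x
  proof -
    have "((\<lambda>x. f (k * (x - c))) has_real_derivative k * f' (k * (x - c))) (at x)" for c
    proof -
      have "((\<lambda>x. k * (x - c)) has_real_derivative k) (at x)"
        by (auto intro!: derivative_eq_intros)
      from DERIV_chain2[OF f this] show ?thesis by (simp add: mult.commute)
    qed
    then show ?thesis unfolding T_def by (intro DERIV_diff)
  qed
  have smooth: "(deriv ^^ n) (T k (\<lambda>x. c * f x)) field_differentiable (at s)" if "f \<in> A" for n k f s c
  proof (rule derivative_closed_imp_smooth)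
    show "T k (\<lambda>x. c * f x) \<in> {T k (\<lambda>x. c * f x) |c f. f \<in> A}" using that by blast
    fix g assume "g \<in> {T k (\<lambda>x. c * f x) |c f. f \<in> A}"
    then obtain c f where g: "g = T k (\<lambda>x. c * f x)" "f \<in> A" by blast
    obtain f' where f': "f' \<in> A" "\<And>x. (f has_real_derivative f' x) (at x)" using A[OF g(2)] by blast
    have "(g has_real_derivative T k (\<lambda>x. (k * c) * f' x) x) (at x)" for x
      using dT[OF DERIV_cmult[OF f'(2)], of k c x] unfolding g by (simp add: mult.assoc)
    moreover have "T k (\<lambda>x. (k * c) * f' x) \<in> {T k (\<lambda>x. c * f x) |c f. f \<in> A}" using f'(1) by blast
    ultimately show "\<exists>g'\<in>{T k (\<lambda>x. c * f x) |c f. f \<in> A}. \<forall>x. (g has_real_derivative g' x) (at x)"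
      by blast
  qed
  have T0: "T k f x = 0" if "k \<ge> 1" "x \<notin> {a..b+1}" "f = S \<or> f = (\<lambda>x. c * \<rho> x)" for k f x c
  proof (cases "x < a")
    case True
    then have "k * (x - a) < 0" "k * (x - b) < 0" using that \<open>a < b\<close> by (auto simp: mult_pos_neg)
    then have "S (k * (x - a)) = 0" "S (k * (x - b)) = 0" "\<rho> (k * (x - a)) = 0" "\<rho> (k * (x - b)) = 0"
      by (simp_all add: S0 \<rho>0)
    then show ?thesis using that(3) by (auto simp: T_def)
  next
    case False
    then have "1 < x - b" "1 < x - a" using that \<open>a < b\<close> by auto
    then have "1 < k * (x - a)" "1 < k * (x - b)" using that by (smt (verit) mult_le_cancel_right1)+
    then have "S (k * (x - a)) = 1" "S (k * (x - b)) = 1" "\<rho> (k * (x - a)) = 0" "\<rho> (k * (x - b)) = 0"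
      by (simp_all add: S1 \<rho>0)
    then show ?thesis using that(3) by (auto simp: T_def)
  qed
  have test: "test_function (T k (\<lambda>x. c * f x))" if "k \<ge> 1" "f \<in> A" "f = S \<or> f = \<rho>" for k f c
  proof -
    have "T k (\<lambda>x. c * f x) s = 0" if "s \<notin> {a..b+1}" for s
    proof -
      have "T k (\<lambda>x. c * f x) s = c * T k f s" by (simp add: T_def algebra_simps)
      moreover have "T k f s = 0"
        using T0[OF \<open>k \<ge> 1\<close> that, of f 1] \<open>f = S \<or> f = \<rho>\<close> by auto
      ultimately show ?thesis by simp
    qed
    then have "{s. T k (\<lambda>x. c * f x) s \<noteq> 0} \<subseteq> {a..b+1}" by blast
    then have "compact (closure {s. T k (\<lambda>x. c * f x) s \<noteq> 0})"
      by (meson bounded_closed_interval bounded_closure bounded_subset closed_closure compact_eq_bounded_closed)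
    then show ?thesis unfolding test_function_def using smooth[OF that(2)] by blast
  qed
  have cont\<rho>: "continuous_on UNIV \<rho>"
    using A[OF S(2)] by (metis DERIV_isCont continuous_at_imp_continuous_on)
  have contS: "continuous_on UNIV S"
    using dS by (metis DERIV_isCont continuous_at_imp_continuous_on)
  have supp\<rho>: "(\<lambda>s. indicator {0..1} s *\<^sub>R \<rho> s) = \<rho>" using \<rho>0 by (force simp: indicator_def)
  have int\<rho>: "integrable lborel \<rho>"
    using borel_integrable_atLeastAtMost'[OF continuous_on_subset[OF cont\<rho>], of 0 1] supp\<rho>
    by (simp add: set_integrable_def)
  have mass: "(LINT s|lborel. \<rho> s) = 1"
    using integral_FTC_atLeastAtMost[of 0 1 S \<rho>] continuous_on_subset[OF cont\<rho>, of "{0..1}"] supp\<rho> S0[of 0] S1[of 1] dS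
    by (simp add: has_real_derivative_iff_has_vector_derivative has_vector_derivative_at_within)
  have meas_y2[measurable]: "y2 \<in> borel_measurable borel"
    using w by (simp add: W2inf_loc_def Linf_loc_def)
  obtain C where C: "AE s in lborel. s \<in> {a..b+1} \<longrightarrow> norm (y2 s) \<le> C"
    using w unfolding W2inf_loc_def Linf_loc_def by blast
  define k where "k n = real (Suc n)" for n
  have k1: "k n \<ge> 1" for n by (simp add: k_def)
  have int_dy: "integrable lborel (\<lambda>s. (k n * \<rho> (k n * (s - c))) *\<^sub>R dy y s)" for n c
  proof -
    have "continuous_on {c..c+1} (\<lambda>s. (k n * \<rho> (k n * (s - c))) *\<^sub>R dy y s)"
      by (intro continuous_intros continuous_on_compose2[OF cont\<rho>] continuous_on_subset[OF C1_funD(3)[OF y]]) auto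
    from borel_integrable_atLeastAtMost'[OF this]
    have "integrable lborel (\<lambda>s. indicator {c..c+1} s *\<^sub>R ((k n * \<rho> (k n * (s - c))) *\<^sub>R dy y s))"
      by (simp add: set_integrable_def)
    also have "(\<lambda>s. indicator {c..c+1} s *\<^sub>R ((k n * \<rho> (k n * (s - c))) *\<^sub>R dy y s))
        = (\<lambda>s. (k n * \<rho> (k n * (s - c))) *\<^sub>R dy y s)"
    proof (intro ext)
      fix s
      have "\<rho> (k n * (s - c)) = 0" if "s \<notin> {c..c+1}"
      proof -
        have "k n * (s - c) < 0 \<or> 1 < k n * (s - c)"
        proof (cases "s < c")
          case True
          then show ?thesis using k1[of n] by (simp add: mult_less_0_iff)
        next
          case False
          then have "1 < s - c" using that by auto
          then have "1 * (s - c) \<le> k n * (s - c)" by (intro mult_right_mono k1) auto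
          then have "1 < k n * (s - c)" unfolding mult_1_left by (rule less_le_trans[OF \<open>1 < s - c\<close>])
          then show ?thesis ..
        qed
        then show ?thesis using \<rho>0 by auto
      qed
      then show "indicator {c..c+1} s *\<^sub>R ((k n * \<rho> (k n * (s - c))) *\<^sub>R dy y s) = (k n * \<rho> (k n * (s - c))) *\<^sub>R dy y s"
        by (cases "s \<in> {c..c+1}") auto
    qed
    finally show ?thesis .
  qed
  have eq: "(LINT s|lborel. (k n * \<rho> (k n * (s - a))) *\<^sub>R dy y s) - (LINT s|lborel. (k n * \<rho> (k n * (s - b))) *\<^sub>R dy y s)
      = - (LINT s|lborel. T (k n) S s *\<^sub>R y2 s)" for n
  proof -
    have d: "deriv (T (k n) S) = T (k n) (\<lambda>x. k n * \<rho> x)"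
      using dT[OF dS] by (intro ext DERIV_imp_deriv)
    have "(LINT s|lborel. (k n * \<rho> (k n * (s - a))) *\<^sub>R dy y s) - (LINT s|lborel. (k n * \<rho> (k n * (s - b))) *\<^sub>R dy y s)
      = (LINT s|lborel. T (k n) (\<lambda>x. k n * \<rho> x) s *\<^sub>R dy y s)"
      by (subst Bochner_Integration.integral_diff[symmetric, OF int_dy int_dy])
        (simp add: T_def scaleR_diff_left)
    also have "\<dots> = (LINT s|lborel. T (k n) (\<lambda>x. k n * \<rho> x) s *\<^sub>R y1 s)"
      using C1_weak_deriv[OF y _ test[OF k1 S(2)]] w by (simp add: W2inf_loc_def)
    also have "\<dots> = - (LINT s|lborel. T (k n) S s *\<^sub>R y2 s)"
    proof -
      have "weak_deriv y1 y2" "test_function (T (k n) S)"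
        using w test[OF k1 S(1), of n 1] by (simp_all add: W2inf_loc_def)
      then show ?thesis unfolding weak_deriv_def d[symmetric] by blast
    qed
    finally show ?thesis .
  qed
  \<comment> \<open>the kernels recover the boundary values of the derivative\<close>
  have lim1: "(\<lambda>n. (LINT s|lborel. (k n * \<rho> (k n * (s - a))) *\<^sub>R dy y s) - (LINT s|lborel. (k n * \<rho> (k n * (s - b))) *\<^sub>R dy y s))
      \<longlonglongrightarrow> dy y a - dy y b"
  proof -
    have "(\<lambda>n. LINT s|lborel. (k n * \<rho> (k n * (s - c))) *\<^sub>R dy y s) \<longlonglongrightarrow> dy y c" for c
      using mollified_value_tendsto[OF C1_funD(3)[OF y] cont\<rho> \<rho>0, of c] int\<rho> mass by (simp add: k_def)
    then show ?thesis by (intro tendsto_diff)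
  qed
  \<comment> \<open>the plateaus have values in the unit interval and a common bounded support\<close>
  have lim2: "(\<lambda>n. LINT s|lborel. T (k n) S s *\<^sub>R y2 s) \<longlonglongrightarrow> (LINT s|lborel. indicator {a<..b} s *\<^sub>R y2 s)"
  proof (rule integral_dominated_convergence[where w="\<lambda>s. indicator {a..b+1} s *\<^sub>R C"])
    show "(\<lambda>s. T (k n) S s *\<^sub>R y2 s) \<in> borel_measurable lborel" for n
    proof -
      have "T (k n) S \<in> borel_measurable borel"
        using contS unfolding T_def
        by (intro borel_measurable_continuous_onI continuous_intros continuous_on_compose2[OF contS]) auto
      then show ?thesis by simp
    qed
    show "integrable lborel (\<lambda>s. indicator {a..b+1} s *\<^sub>R C)"
      using borel_integrable_atLeastAtMost'[OF continuous_on_const] unfolding set_integrable_def .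
    show "AE s in lborel. (\<lambda>n. T (k n) S s *\<^sub>R y2 s) \<longlonglongrightarrow> indicator {a<..b} s *\<^sub>R y2 s"
    proof (intro AE_I2 tendsto_intros)
      fix s :: real
      have step: "(\<lambda>n. S (k n * (s - c))) \<longlonglongrightarrow> indicator {c<..} s" for c
      proof (cases "c < s")
        case True
        have "filterlim k at_top sequentially"
          unfolding k_def using filterlim_Suc filterlim_real_sequentially filterlim_compose by blast
        then have "filterlim (\<lambda>n. k n * (s - c)) at_top sequentially"
          using True by (intro filterlim_at_top_mult_tendsto_pos[OF tendsto_const]) auto
        then have "\<forall>\<^sub>F n in sequentially. 1 \<le> k n * (s - c)" by (simp add: filterlim_at_top)
        then have "\<forall>\<^sub>F n in sequentially. S (k n * (s - c)) = 1" by eventually_elim (rule S1)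
        then show ?thesis using True by (simp add: tendsto_eventually)
      next
        case False
        then have "S (k n * (s - c)) = 0" for n
          using k1[of n] by (intro S0) (simp add: mult_nonneg_nonpos)
        then show ?thesis using False by simp
      qed
      have "(indicator {a<..} s - indicator {b<..} s :: real) = indicator {a<..b} s"
        using \<open>a < b\<close> by (auto simp: indicator_def)
      with tendsto_diff[OF step[of a] step[of b]]
      show "(\<lambda>n. T (k n) S s) \<longlonglongrightarrow> indicator {a<..b} s" by (simp add: T_def)
    qed
    show "AE s in lborel. norm (T (k n) S s *\<^sub>R y2 s) \<le> indicator {a..b+1} s *\<^sub>R C" for n
      using C
    proof eventually_elim
      case (elim s)
      show ?case
      proof (cases "s \<in> {a..b+1}")
        case True
        have "\<bar>T (k n) S s\<bar> \<le> 1"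
          using S01[of "k n * (s - a)"] S01[of "k n * (s - b)"] by (auto simp: T_def abs_if)
        then have "\<bar>T (k n) S s\<bar> * norm (y2 s) \<le> 1 * C"
          using elim True by (intro mult_mono) auto
        then show ?thesis using True by simp
      next
        case False
        then show ?thesis using T0[OF k1 False, of S] by simp
      qed
    qed
  qed measurable
  have "dy y a - dy y b = - (LINT s|lborel. indicator {a<..b} s *\<^sub>R y2 s)"
    using lim1 tendsto_minus[OF lim2] by (intro LIMSEQ_unique) (simp_all add: eq)
  moreover have "(LINT s|lborel. indicator {a<..b} s *\<^sub>R y2 s) = (LINT s|lborel. indicator {a..b} s *\<^sub>R y2 s)"
  proof (rule integral_cong_AE)
    show "AE s in lborel. indicator {a<..b} s *\<^sub>R y2 s = indicator {a..b} s *\<^sub>R y2 s"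
      using AE_lborel_singleton[of a] by eventually_elim (auto simp: indicator_def)
  qed measurable
  ultimately show ?thesis by (simp add: set_lebesgue_integral_def algebra_simps)
qed

section \<open>Estimates and unique continuation for abnormal solutions\<close>

locale abnormal_solution =
  fixes n1 n2 :: real and \<kappa> :: complex and y :: "real \<Rightarrow> complex"
  assumes n1: "0 < n1" and n12: "n1 < n2" and Re_\<kappa>: "Re \<kappa> > 0" and Im_\<kappa>: "Im \<kappa> < 0"
    and solution: "nontrivial_solution n1 n2 \<kappa> y"
    and energy: "\<And>s. Im (of_real (permittivity n1 n2 y s) * (y s)\<^sup>2 + (dy y s)\<^sup>2 / \<kappa>\<^sup>2) = 0"
begin

abbreviation \<epsilon> :: "real \<Rightarrow> real" where "\<epsilon> \<equiv> permittivity n1 n2 y"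

text \<open>
  Dividing by \<open>\<kappa>\<close> turns the conserved quantity into \<open>\<epsilon> y\<^sup>2 + p\<^sup>2\<close>.
\<close>

definition p :: "real \<Rightarrow> complex" where "p s = dy y s / \<kappa>"

lemma \<kappa>_nonzero: "\<kappa> \<noteq> 0"
  using Re_\<kappa> by auto

lemma dy_eq: "dy y s = \<kappa> * p s"
  using \<kappa>_nonzero by (simp add: p_def)

lemma C1: "C1_fun y"
  using solution by (simp add: nontrivial_solution_def)

lemmas y_deriv = C1_funD(1)[OF C1]

lemma y_cont: "isCont y s" and p_cont: "isCont p s"
  using C1_funD(2,3)[OF C1] \<kappa>_nonzero unfolding p_def
  by (auto simp: continuous_on_eq_continuous_at intro!: continuous_intros)

lemma \<epsilon>_eq: "\<epsilon> s = (if Im ((y s)\<^sup>2) > 0 then n2\<^sup>2 else n1\<^sup>2)"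
  by (simp add: permittivity_def)

lemma squares: "0 < n1\<^sup>2" "n1\<^sup>2 < n2\<^sup>2"
  using n1 n12 by (auto intro: power_strict_mono)

lemma \<epsilon>_bounds: "n1\<^sup>2 \<le> \<epsilon> s" "\<epsilon> s \<le> n2\<^sup>2"
  using squares by (auto simp: \<epsilon>_eq)

lemma \<epsilon>_pos: "0 < \<epsilon> s"
  using \<epsilon>_bounds[of s] squares by linarith

lemma \<epsilon>_abs: "\<bar>\<epsilon> s\<bar> \<le> n2\<^sup>2"
  using \<epsilon>_bounds[of s] \<epsilon>_pos[of s] by simp

lemma energy_balance: "\<epsilon> s * Im ((y s)\<^sup>2) = - Im ((p s)\<^sup>2)"
  using energy[of s] by (simp add: p_def power_divide)

text \<open>
  In the abnormal case \<open>Im (p\<^sup>2)\<close> has the sign opposite to \<open>Im (y\<^sup>2)\<close>.  So \<open>\<epsilon>\<close> can be read off from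
  \<open>p\<close> wherever \<open>p\<close> is easier to expand than \<open>y\<close>.
\<close>

lemma Im_p_square_pos_iff: "Im ((p s)\<^sup>2) < 0 \<longleftrightarrow> Im ((y s)\<^sup>2) > 0"
  and Im_p_square_0_iff: "Im ((p s)\<^sup>2) = 0 \<longleftrightarrow> Im ((y s)\<^sup>2) = 0"
proof -
  have "sgn (Im ((y s)\<^sup>2)) = - sgn (Im ((p s)\<^sup>2))"
    using arg_cong[OF energy_balance[of s], of sgn] \<epsilon>_pos[of s] by (simp only: sgn_mult sgn_pos sgn_minus mult_1_left)
  then show "Im ((p s)\<^sup>2) < 0 \<longleftrightarrow> Im ((y s)\<^sup>2) > 0" "Im ((p s)\<^sup>2) = 0 \<longleftrightarrow> Im ((y s)\<^sup>2) = 0"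
    by (auto simp: sgn_if split: if_splits)
qed

lemma \<epsilon>_measurable: "\<epsilon> \<in> borel_measurable borel"
proof -
  have "y \<in> borel_measurable borel"
    using C1_funD(2)[OF C1] by (rule borel_measurable_continuous_onI)
  then have [measurable]: "(\<lambda>s. Im ((y s)\<^sup>2)) \<in> borel_measurable borel" by measurable
  show ?thesis unfolding \<epsilon>_eq[abs_def] by measurable
qed

lemma \<epsilon>_integrable: "\<epsilon> integrable_on {a..b}"
proof -
  note [measurable] = \<epsilon>_measurable
  have "set_integrable lborel {a..b} \<epsilon>"
    unfolding set_integrable_def
  proof (rule Bochner_Integration.integrable_bound)
    show "integrable lborel (\<lambda>s. indicator {a..b} s *\<^sub>R n2\<^sup>2)"
      using borel_integrable_atLeastAtMost'[OF continuous_on_const] unfolding set_integrable_def .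
    show "AE s in lborel. norm (indicator {a..b} s *\<^sub>R \<epsilon> s) \<le> norm (indicator {a..b} s *\<^sub>R n2\<^sup>2)"
      using \<epsilon>_abs by (intro AE_I2) (auto simp: indicator_def)
  qed measurable
  then show ?thesis by (rule set_borel_integral_eq_integral)
qed

lemma p_integral:
  assumes "a < b"
  shows "((\<lambda>s. \<kappa> * \<epsilon> s * y s) has_integral (p a - p b)) {a..b}"
proof -
  obtain y1 y2 where w: "W2inf_loc y y1 y2" and ae: "AE s in lborel. - y2 s = \<kappa>\<^sup>2 * y s * of_real (\<epsilon> s)"
    using solution by (auto simp: nontrivial_solution_def)
  note [measurable] = \<epsilon>_measurable
  have [measurable]: "y \<in> borel_measurable borel" "y2 \<in> borel_measurable borel"
    using w by (auto simp: W2inf_loc_def Linf_loc_def)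
  have "compact (y ` {a..b})"
    by (intro compact_continuous_image continuous_on_subset[OF C1_funD(2)[OF C1]]) auto
  then obtain B where B: "\<And>s. s \<in> {a..b} \<Longrightarrow> norm (y s) \<le> B"
    by (metis compact_imp_bounded bounded_iff imageI)
  have si: "set_integrable lborel {a..b} (\<lambda>s. \<kappa>\<^sup>2 * y s * of_real (\<epsilon> s))"
    unfolding set_integrable_def
  proof (rule Bochner_Integration.integrable_bound)
    show "integrable lborel (\<lambda>s. indicator {a..b} s *\<^sub>R (norm (\<kappa>\<^sup>2) * B * n2\<^sup>2))"
      using borel_integrable_atLeastAtMost'[OF continuous_on_const] unfolding set_integrable_def .
    have "norm (\<kappa>\<^sup>2) * norm (y s) * \<bar>\<epsilon> s\<bar> \<le> norm (\<kappa>\<^sup>2) * B * n2\<^sup>2" if "s \<in> {a..b}" for s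
      using B[OF that] \<epsilon>_abs[of s] order_trans[OF norm_ge_zero B[OF that]]
      by (intro mult_mono) auto
    then show "AE s in lborel. norm (indicator {a..b} s *\<^sub>R (\<kappa>\<^sup>2 * y s * of_real (\<epsilon> s)))
        \<le> norm (indicator {a..b} s *\<^sub>R (norm (\<kappa>\<^sup>2) * B * n2\<^sup>2))"
      by (intro AE_I2) (auto simp: indicator_def norm_mult mult_ac intro!: order_trans[OF _ abs_ge_self])
  qed measurable
  have "(LINT s:{a..b}|lborel. \<kappa>\<^sup>2 * y s * of_real (\<epsilon> s)) = (LINT s:{a..b}|lborel. - y2 s)"
    unfolding set_lebesgue_integral_def
    by (rule integral_cong_AE) (measurable, measurable, use ae in eventually_elim, simp)
  also have "\<dots> = dy y a - dy y b"
    using W2inf_loc_second_deriv_integral[OF C1 w \<open>a < b\<close>]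
    by (simp add: set_lebesgue_integral_def)
  finally have "((\<lambda>s. \<kappa>\<^sup>2 * y s * of_real (\<epsilon> s)) has_integral (dy y a - dy y b)) {a..b}"
    using set_borel_integral_eq_integral[OF si] by (simp add: has_integral_integral)
  from has_integral_mult_right[OF this, of "1 / \<kappa>"] show ?thesis
    using \<kappa>_nonzero by (simp add: p_def power2_eq_square diff_divide_distrib mult_ac)
qed

text \<open>
  The quantitative form of the differential equation in which it is used throughout: where \<open>y\<close> is
  close to a constant \<open>c\<close>, the increment of \<open>p\<close> is governed by the mean of \<open>\<epsilon>\<close>.  With \<open>c = 0\<close> it
  is a Gronwall-type bound, with \<open>c = y s\<close> an expansion at \<open>s\<close>.
\<close>

lemma p_increment:
  assumes "a < b" and \<eta>: "\<And>s. s \<in> {a..b} \<Longrightarrow> norm (y s - c) \<le> \<eta>"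
  shows "norm (p b - p a + \<kappa> * c * integral {a..b} \<epsilon>) \<le> norm \<kappa> * n2\<^sup>2 * \<eta> * (b - a)"
proof -
  have "((\<lambda>s. complex_of_real (\<epsilon> s)) has_integral of_real (integral {a..b} \<epsilon>)) {a..b}"
    using has_integral_linear[OF integrable_integral[OF \<epsilon>_integrable] bounded_linear_of_real]
    by (simp add: o_def)
  from has_integral_diff[OF p_integral[OF \<open>a < b\<close>] has_integral_mult_right[OF this, of "\<kappa> * c"]]
  have "((\<lambda>s. \<kappa> * \<epsilon> s * (y s - c)) has_integral (p a - p b - \<kappa> * c * integral {a..b} \<epsilon>)) {a..b}"
    by (simp add: algebra_simps)
  moreover have "norm (\<kappa> * \<epsilon> s * (y s - c)) \<le> norm \<kappa> * n2\<^sup>2 * \<eta>" if "s \<in> {a..b}" for s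
    using \<eta>[OF that] \<epsilon>_abs[of s] order_trans[OF norm_ge_zero \<eta>[OF that]]
    by (auto simp: norm_mult intro!: mult_mono)
  moreover have "0 \<le> \<eta>" using order_trans[OF norm_ge_zero \<eta>[of a]] \<open>a < b\<close> by simp
  ultimately have "norm (p a - p b - \<kappa> * c * integral {a..b} \<epsilon>) \<le> norm \<kappa> * n2\<^sup>2 * \<eta> * measure lborel {a..b}"
    by (intro has_integral_bound_real[where S="{}" and f="\<lambda>s. \<kappa> * \<epsilon> s * (y s - c)"]) auto
  moreover have "p a - p b - \<kappa> * c * integral {a..b} \<epsilon> = - (p b - p a + \<kappa> * c * integral {a..b} \<epsilon>)"
    by (simp add: algebra_simps)
  ultimately show ?thesis using \<open>a < b\<close> by (simp only: norm_minus_cancel content_real less_imp_le)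
qed

lemma \<epsilon>_integral_lower:
  assumes "a \<le> b" shows "n1\<^sup>2 * (b - a) \<le> integral {a..b} \<epsilon>"
proof -
  have "integral {a..b} (\<lambda>_. n1\<^sup>2) \<le> integral {a..b} \<epsilon>"
    using \<epsilon>_bounds by (intro integral_le \<epsilon>_integrable) auto
  then show ?thesis using assms by (simp add: mult.commute)
qed

text \<open>
  On an interval so short that the combined bound for \<open>p\<close> by \<open>y\<close> and for \<open>y\<close> by \<open>p\<close> is a
  contraction, the maximum of \<open>norm y\<close> is less than itself unless it is zero.
\<close>

lemma zero_data_spreads:
  assumes "y s = 0" "p s = 0" and small: "0 < h" "norm \<kappa> * norm \<kappa> * n2\<^sup>2 * h * h < 1" and t: "\<bar>t - s\<bar> \<le> h"
  shows "y t = 0 \<and> p t = 0"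
proof -
  define I where "I = {s-h..s+h}"
  have "compact I" "I \<noteq> {}" using small by (auto simp: I_def)
  have "continuous_on I (\<lambda>t. norm (y t))"
    by (intro continuous_intros continuous_on_subset[OF C1_funD(2)[OF C1]]) auto
  from continuous_attains_sup[OF \<open>compact I\<close> \<open>I \<noteq> {}\<close> this]
  obtain m where m: "m \<in> I" and max: "\<And>t. t \<in> I \<Longrightarrow> norm (y t) \<le> norm (y m)"
    by blast
  define M where "M = norm (y m)"
  have p_le: "norm (p t) \<le> norm \<kappa> * n2\<^sup>2 * M * h" if "t \<in> I" for t
  proof -
    have "norm (p t) \<le> norm \<kappa> * n2\<^sup>2 * M * \<bar>t - s\<bar>"
    proof (cases t s rule: linorder_cases)
      case less
      then show ?thesis using p_increment[of t s 0 M] max that assms(2) by (auto simp: M_def I_def)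
    next
      case greater
      then show ?thesis using p_increment[of s t 0 M] max that assms(2) by (auto simp: M_def I_def)
    qed (use assms in simp)
    also have "\<dots> \<le> norm \<kappa> * n2\<^sup>2 * M * h"
      using that by (intro mult_left_mono) (auto simp: I_def M_def)
    finally show ?thesis .
  qed
  have "norm (y m - y s) \<le> (norm \<kappa> * (norm \<kappa> * n2\<^sup>2 * M * h)) * norm (m - s)"
  proof (rule differentiable_bound[of I y "\<lambda>t h. h *\<^sub>R dy y t"])
    show "(y has_derivative (\<lambda>h. h *\<^sub>R dy y t)) (at t within I)" for t
      using y_deriv[of t] has_derivative_at_withinI by (auto simp: has_vector_derivative_def)
    show "onorm (\<lambda>h. h *\<^sub>R dy y t) \<le> norm \<kappa> * (norm \<kappa> * n2\<^sup>2 * M * h)" if "t \<in> I" for t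
      using p_le[OF that]
      by (intro onorm_le) (simp add: dy_eq norm_mult mult.commute mult_left_mono)
  qed (use m small in \<open>auto simp: I_def\<close>)
  also have "\<dots> \<le> (norm \<kappa> * (norm \<kappa> * n2\<^sup>2 * M * h)) * h"
    using m small by (intro mult_left_mono) (auto simp: I_def M_def)
  finally have "M \<le> (norm \<kappa> * norm \<kappa> * n2\<^sup>2 * h * h) * M"
    using assms(1) by (simp add: M_def mult_ac)
  then have "M \<le> 0"
    using mult_strict_right_mono[OF small(2), of M] by (cases "0 < M") auto
  then have M: "M = 0" by (simp add: M_def)
  have "t \<in> I" using t by (auto simp: I_def)
  then show ?thesis using max[of t] p_le[of t] M by (simp add: M_def)
qed

text \<open>
  Uniqueness for the Cauchy problem.  The step length of the preceding lemma does not depend on the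
  point, so the common zeros of \<open>y\<close> and \<open>p\<close> form an open and closed set, which is empty for a
  nontrivial solution.
\<close>

lemma no_double_zero: "y s \<noteq> 0 \<or> p s \<noteq> 0"
proof (rule ccontr)
  assume s: "\<not> (y s \<noteq> 0 \<or> p s \<noteq> 0)"
  define K where "K = norm \<kappa> * norm \<kappa> * n2\<^sup>2"
  have K: "0 \<le> K" by (simp add: K_def)
  define h where "h = 1 / (K + 1)"
  have h: "0 < h" using K by (simp add: h_def)
  have "K * h < 1" "h \<le> 1" using K by (auto simp: h_def)
  then have small: "K * h * h < 1"
    using mult_mono[of "K * h" "K * h" h 1] h K by simp
  define Z where "Z = {t. y t = 0 \<and> p t = 0}"
  have "open Z"
  proof (unfold open_dist, intro ballI exI conjI allI impI)
    fix t r assume "t \<in> Z" "dist r t < h"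
    then show "r \<in> Z" using zero_data_spreads[of t h r] h small
      by (auto simp: Z_def K_def dist_real_def)
  qed (rule h)
  moreover have "closed Z"
  proof -
    have "closed {t. y t = 0}" "closed {t. p t = 0}"
      using y_cont p_cont by (auto intro!: closed_Collect_eq continuous_at_imp_continuous_on)
    then show ?thesis unfolding Z_def Collect_conj_eq by (rule closed_Int)
  qed
  ultimately have "Z = {} \<or> Z = UNIV" using clopen by blast
  moreover have "s \<in> Z" using s by (simp add: Z_def)
  ultimately have "Z = UNIV" by auto
  then show False using solution by (auto simp: Z_def nontrivial_solution_def)
qed

end

section \<open>Characterization of the switch points\<close>

lemma eventually_sgn_eq_of_tendsto:
  fixes f m :: "real \<Rightarrow> real"
  assumes "((\<lambda>t. f t / m t) \<longlongrightarrow> L) F" and "L \<noteq> 0" and "\<forall>\<^sub>F t in F. 0 < m t"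
  shows "\<forall>\<^sub>F t in F. sgn (f t) = sgn L"
proof (cases "0 < L")
  case True
  then have "\<forall>\<^sub>F t in F. 0 < f t / m t" using order_tendstoD(1)[OF assms(1)] by blast
  with assms(3) show ?thesis
    by eventually_elim (use True in \<open>simp add: zero_less_divide_iff\<close>)
next
  case False
  then have "L < 0" using assms(2) by simp
  then have "\<forall>\<^sub>F t in F. f t / m t < 0" using order_tendstoD(2)[OF assms(1)] by blast
  with assms(3) show ?thesis
    by eventually_elim (use \<open>L < 0\<close> in \<open>simp add: divide_less_0_iff\<close>)
qed

lemma Im_square_scaleR: "Im ((z /\<^sub>R r)\<^sup>2) = Im (z\<^sup>2) / r\<^sup>2"
  by (simp add: power2_eq_square field_simps)

lemma difference_quotient_tendsto:
  assumes "(f has_vector_derivative D) (at s)"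
  shows "((\<lambda>t. (f t - f s) /\<^sub>R (t - s)) \<longlongrightarrow> D) (at s)"
proof -
  have "((\<lambda>t. norm ((f t - f s) - (t - s) *\<^sub>R D) / norm (t - s)) \<longlongrightarrow> 0) (at s)"
    using assms by (simp add: has_vector_derivative_def has_derivative_iff_norm)
  then have "((\<lambda>t. norm ((f t - f s) /\<^sub>R (t - s) - D)) \<longlongrightarrow> 0) (at s)"
  proof (rule Lim_transform_eventually)
    show "\<forall>\<^sub>F t in at s. norm ((f t - f s) - (t - s) *\<^sub>R D) / norm (t - s) = norm ((f t - f s) /\<^sub>R (t - s) - D)"
      unfolding eventually_at_filter
    proof (intro always_eventually allI impI)
      fix t assume "t \<noteq> s"
      then have "(f t - f s) /\<^sub>R (t - s) - D = ((f t - f s) - (t - s) *\<^sub>R D) /\<^sub>R (t - s)"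
        by (simp add: scaleR_diff_right)
      then show "norm ((f t - f s) - (t - s) *\<^sub>R D) / norm (t - s) = norm ((f t - f s) /\<^sub>R (t - s) - D)"
        by (simp add: divide_inverse mult.commute)
    qed
  qed
  then show ?thesis by (rule LIM_zero_cancel[OF tendsto_norm_zero_cancel])
qed

context abnormal_solution
begin

lemma Im_\<kappa>_square: "Im (\<kappa>\<^sup>2) < 0"
  using Re_\<kappa> Im_\<kappa> by (simp add: power2_eq_square mult_pos_neg mult_neg_pos)

text \<open>
  At a zero of \<open>y\<close> or of \<open>p\<close>, the other function has real nonzero square there, and the leading
  coefficient of \<open>y\<^sup>2\<close>, respectively \<open>p\<^sup>2\<close>, is that number times \<open>\<kappa>\<^sup>2\<close>.  This lemma says
  that the leading coefficient is not real.
\<close>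

lemma Im_\<kappa>_square_times:
  assumes "Im (z\<^sup>2) = 0" and "z \<noteq> 0"
  shows "Im ((\<kappa> * z)\<^sup>2) \<noteq> 0"
proof -
  have "Re (z\<^sup>2) \<noteq> 0" using assms complex_eq_iff[of "z\<^sup>2" 0] by simp
  moreover have "Im ((\<kappa> * z)\<^sup>2) = Im (\<kappa>\<^sup>2) * Re (z\<^sup>2)"
    using assms(1) by (simp only: power_mult_distrib times_complex.simps)
  ultimately show ?thesis using Im_\<kappa>_square by simp
qed

text \<open>
  Away from zeros of \<open>y\<close> and \<open>p\<close>, the derivative of \<open>Im (y\<^sup>2)\<close> is \<open>2 Im (\<kappa> y p)\<close>.  Where \<open>y\<^sup>2\<close> and
  \<open>p\<^sup>2\<close> are real, \<open>y p\<close> lies on one of the axes, and \<open>\<kappa>\<close> lies on neither.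
\<close>

lemma Im_\<kappa>_times:
  assumes "Im (z\<^sup>2) = 0" and "z \<noteq> 0"
  shows "Im (\<kappa> * z) \<noteq> 0"
proof -
  have "Re z = 0 \<or> Im z = 0" using assms(1) by (auto simp: power2_eq_square)
  moreover have "Re z \<noteq> 0 \<or> Im z \<noteq> 0" using assms(2) by (simp add: complex_eq_iff)
  ultimately show ?thesis using Re_\<kappa> Im_\<kappa> by auto
qed

lemma \<epsilon>_eventually_const:
  assumes "\<forall>\<^sub>F t in F. (0 < Im ((y t)\<^sup>2)) = P"
  shows "\<forall>\<^sub>F t in F. \<epsilon> t = (if P then n2\<^sup>2 else n1\<^sup>2)"
  using assms by eventually_elim (simp add: \<epsilon>_eq)

lemma \<epsilon>_const_near_nonreal:
  assumes "Im ((y s)\<^sup>2) \<noteq> 0"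
  shows "\<exists>l\<in>{n1\<^sup>2, n2\<^sup>2}. \<forall>\<^sub>F t in at s. \<epsilon> t = l"
proof -
  have "((\<lambda>t. Im ((y t)\<^sup>2) / 1) \<longlongrightarrow> Im ((y s)\<^sup>2)) (at s)"
    using y_cont[of s] by (auto simp: isCont_def intro!: tendsto_eq_intros)
  then have "\<forall>\<^sub>F t in at s. sgn (Im ((y t)\<^sup>2)) = sgn (Im ((y s)\<^sup>2))"
    by (rule eventually_sgn_eq_of_tendsto) (use assms in auto)
  then have "\<forall>\<^sub>F t in at s. (0 < Im ((y t)\<^sup>2)) = (0 < Im ((y s)\<^sup>2))"
    by eventually_elim (metis sgn_greater)
  from \<epsilon>_eventually_const[OF this] show ?thesis by (auto split: if_splits)
qed

text \<open>
  Here \<open>y\<^sup>2\<close> vanishes to second order with nonreal leading coefficient, so \<open>Im (y\<^sup>2)\<close> has the same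
  sign on both sides.
\<close>

lemma \<epsilon>_const_near_zero:
  assumes "y s = 0"
  shows "\<exists>l\<in>{n1\<^sup>2, n2\<^sup>2}. \<forall>\<^sub>F t in at s. \<epsilon> t = l"
proof -
  have L: "Im ((dy y s)\<^sup>2) \<noteq> 0"
    using Im_\<kappa>_square_times[of "p s"] no_double_zero[of s] Im_p_square_0_iff[of s] assms
    by (simp add: dy_eq)
  have "((\<lambda>t. Im (((y t - y s) /\<^sub>R (t - s))\<^sup>2)) \<longlongrightarrow> Im ((dy y s)\<^sup>2)) (at s)"
    by (intro tendsto_intros difference_quotient_tendsto y_deriv)
  then have "((\<lambda>t. Im ((y t)\<^sup>2) / (t - s)\<^sup>2) \<longlongrightarrow> Im ((dy y s)\<^sup>2)) (at s)"
    using assms by (simp only: Im_square_scaleR diff_0_right)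
  then have "\<forall>\<^sub>F t in at s. sgn (Im ((y t)\<^sup>2)) = sgn (Im ((dy y s)\<^sup>2))"
    by (rule eventually_sgn_eq_of_tendsto) (use L in \<open>auto simp: eventually_at_filter\<close>)
  then have "\<forall>\<^sub>F t in at s. (0 < Im ((y t)\<^sup>2)) = (0 < Im ((dy y s)\<^sup>2))"
    by eventually_elim (metis sgn_greater)
  from \<epsilon>_eventually_const[OF this] show ?thesis by (auto split: if_splits)
qed

text \<open>
  The dual situation, read off from \<open>p\<close>: near \<open>s\<close> the function \<open>p\<close> behaves like \<open>- \<kappa> y(s) m\<close>, where
  the real signed integral \<open>m\<close> of \<open>\<epsilon>\<close> from \<open>s\<close> replaces the distance to \<open>s\<close>.  The
  quotient of \<open>p\<close> by the distance itself could oscillate if \<open>\<epsilon>\<close> had no limit at \<open>s\<close>.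
\<close>

lemma \<epsilon>_const_near_critical:
  assumes "p s = 0"
  shows "\<exists>l\<in>{n1\<^sup>2, n2\<^sup>2}. \<forall>\<^sub>F t in at s. \<epsilon> t = l"
proof -
  define m where "m t = (if s < t then integral {s..t} \<epsilon> else - integral {t..s} \<epsilon>)" for t
  have m_lower: "n1\<^sup>2 * \<bar>t - s\<bar> \<le> \<bar>m t\<bar>" for t
    using \<epsilon>_integral_lower[of s t] \<epsilon>_integral_lower[of t s] by (auto simp: m_def abs_if)
  have m0: "m t \<noteq> 0" if "t \<noteq> s" for t
  proof -
    have "0 < n1\<^sup>2 * \<bar>t - s\<bar>" using that squares by simp
    then show ?thesis using m_lower[of t] by auto
  qed
  define K where "K = norm \<kappa> * n2\<^sup>2 / n1\<^sup>2"
  have K: "0 < K" using squares \<kappa>_nonzero unfolding K_def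
    by (intro divide_pos_pos mult_pos_pos) auto
  have close: "norm (p t /\<^sub>R m t - (- (\<kappa> * y s))) \<le> K * \<eta>"
    if \<eta>: "\<And>r. \<bar>r - s\<bar> \<le> \<bar>t - s\<bar> \<Longrightarrow> norm (y r - y s) \<le> \<eta>" and "t \<noteq> s" for t \<eta>
  proof -
    have "0 \<le> \<eta>" using order_trans[OF norm_ge_zero \<eta>[of s]] by simp
    have "norm (p t + \<kappa> * y s * m t) \<le> norm \<kappa> * n2\<^sup>2 * \<eta> * \<bar>t - s\<bar>"
    proof (cases t s rule: linorder_cases)
      case less
      have "norm (p s - p t + \<kappa> * y s * integral {t..s} \<epsilon>) \<le> norm \<kappa> * n2\<^sup>2 * \<eta> * (s - t)"
        using less by (intro p_increment \<eta>) auto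
      moreover have "p s - p t + \<kappa> * y s * integral {t..s} \<epsilon> = - (p t + \<kappa> * y s * m t)"
        using less assms by (simp add: m_def)
      moreover have "\<bar>t - s\<bar> = s - t" using less by simp
      ultimately show ?thesis by (simp only: norm_minus_cancel)
    next
      case greater
      have "norm (p t - p s + \<kappa> * y s * integral {s..t} \<epsilon>) \<le> norm \<kappa> * n2\<^sup>2 * \<eta> * (t - s)"
        using greater by (intro p_increment \<eta>) auto
      then show ?thesis using greater assms by (simp add: m_def)
    qed (use that in simp)
    also have "\<dots> \<le> norm \<kappa> * n2\<^sup>2 * \<eta> * (\<bar>m t\<bar> / n1\<^sup>2)"
      using m_lower[of t] squares \<open>0 \<le> \<eta>\<close> by (intro mult_left_mono) (auto simp: field_simps)
    also have "\<dots> = K * \<eta> * \<bar>m t\<bar>" by (simp add: K_def)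
    finally have "norm (p t + \<kappa> * y s * m t) / \<bar>m t\<bar> \<le> K * \<eta>"
      using m0[OF \<open>t \<noteq> s\<close>] by (simp add: divide_le_eq)
    moreover have "p t /\<^sub>R m t - (- (\<kappa> * y s)) = (p t + \<kappa> * y s * m t) /\<^sub>R m t"
      using m0[OF \<open>t \<noteq> s\<close>] by (simp add: scaleR_conv_of_real field_simps)
    ultimately show ?thesis by (simp add: divide_inverse mult.commute)
  qed
  have "((\<lambda>t. p t /\<^sub>R m t) \<longlongrightarrow> - (\<kappa> * y s)) (at s)"
  proof (rule tendstoI)
    fix e :: real assume "0 < e"
    then have e: "0 < e / (2 * K)" using K by simp
    obtain d where d: "0 < d" "\<And>r. dist r s < d \<Longrightarrow> dist (y r) (y s) < e / (2 * K)"
      using y_cont[of s] e unfolding continuous_at_eps_delta by (metis dist_norm real_norm_def)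
    have "dist (p t /\<^sub>R m t) (- (\<kappa> * y s)) < e" if "t \<noteq> s" "dist t s < d" for t
    proof -
      have "norm (p t /\<^sub>R m t - (- (\<kappa> * y s))) \<le> K * (e / (2 * K))"
      proof (rule close[OF _ \<open>t \<noteq> s\<close>])
        show "norm (y r - y s) \<le> e / (2 * K)" if "\<bar>r - s\<bar> \<le> \<bar>t - s\<bar>" for r
          using d(2)[of r] that \<open>dist t s < d\<close> by (auto simp: dist_norm)
      qed
      also have "\<dots> < e" using K \<open>0 < e\<close> by simp
      finally show ?thesis by (simp only: dist_norm)
    qed
    then show "\<forall>\<^sub>F t in at s. dist (p t /\<^sub>R m t) (- (\<kappa> * y s)) < e"
      unfolding eventually_at using d(1) by blast
  qed
  then have "((\<lambda>t. Im ((p t /\<^sub>R m t)\<^sup>2)) \<longlongrightarrow> Im ((- (\<kappa> * y s))\<^sup>2)) (at s)"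
    by (intro tendsto_intros)
  then have "((\<lambda>t. Im ((p t)\<^sup>2) / (m t)\<^sup>2) \<longlongrightarrow> Im ((\<kappa> * y s)\<^sup>2)) (at s)"
    by (simp only: Im_square_scaleR power2_minus)
  moreover have "Im ((\<kappa> * y s)\<^sup>2) \<noteq> 0"
    using Im_\<kappa>_square_times[of "y s"] no_double_zero[of s] Im_p_square_0_iff[of s] assms by simp
  moreover have "\<forall>\<^sub>F t in at s. 0 < (m t)\<^sup>2"
    using m0 by (auto simp: eventually_at_filter)
  ultimately have "\<forall>\<^sub>F t in at s. sgn (Im ((p t)\<^sup>2)) = sgn (Im ((\<kappa> * y s)\<^sup>2))"
    by (rule eventually_sgn_eq_of_tendsto)
  then have "\<forall>\<^sub>F t in at s. (0 < Im ((y t)\<^sup>2)) = (Im ((\<kappa> * y s)\<^sup>2) < 0)"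
    by eventually_elim (metis sgn_less Im_p_square_pos_iff)
  from \<epsilon>_eventually_const[OF this] show ?thesis by (auto split: if_splits)
qed

lemma switch_at_transversal_crossing:
  assumes "Im ((y s)\<^sup>2) = 0" "y s \<noteq> 0" "p s \<noteq> 0"
  shows "s \<in> switch_points \<epsilon>"
proof -
  define g where "g t = Im ((y t)\<^sup>2)" for t
  define D where "D = Im (2 * y s * dy y s)"
  have "((\<lambda>t. y t * y t) has_vector_derivative (y s * dy y s + dy y s * y s)) (at s)"
    by (rule has_vector_derivative_mult[OF y_deriv y_deriv])
  then have g: "(g has_real_derivative D) (at s)"
    unfolding has_real_derivative_iff_has_vector_derivative g_def D_def power2_eq_square
    using bounded_linear.has_vector_derivative[OF bounded_linear_Im]
    by (fastforce simp: algebra_simps)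
  have "Im ((y s * p s)\<^sup>2) = 0"
    using assms(1) Im_p_square_0_iff[of s] by (simp only: power_mult_distrib times_complex.simps) simp
  then have "Im (\<kappa> * (y s * p s)) \<noteq> 0" using assms by (intro Im_\<kappa>_times) auto
  then have D: "D \<noteq> 0" by (simp add: D_def dy_eq algebra_simps)
  have g0: "g s = 0" using assms by (simp add: g_def)
  have "\<exists>P. (\<forall>\<^sub>F t in at_left s. (0 < g t) = P) \<and> (\<forall>\<^sub>F t in at_right s. (0 < g t) = (\<not> P))"
  proof (cases "0 < D")
    case True
    obtain d where d: "0 < d" "\<And>h. 0 < h \<Longrightarrow> h < d \<Longrightarrow> g s < g (s + h)"
      using DERIV_pos_inc_right[OF g True] by auto
    obtain d' where d': "0 < d'" "\<And>h. 0 < h \<Longrightarrow> h < d' \<Longrightarrow> g (s - h) < g s"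
      using DERIV_pos_inc_left[OF g True] by auto
    have "\<forall>\<^sub>F t in at_left s. (0 < g t) = False"
      unfolding eventually_at_left_field
      using d'(1) d'(2)[of "s - t" for t] g0 by (intro exI[of _ "s - d'"]) force
    moreover have "\<forall>\<^sub>F t in at_right s. (0 < g t) = True"
      unfolding eventually_at_right_field
      using d(1) d(2)[of "t - s" for t] g0 by (intro exI[of _ "s + d"]) force
    ultimately show ?thesis by (intro exI[of _ False]) simp
  next
    case False
    then have "D < 0" using D by simp
    obtain d where d: "0 < d" "\<And>h. 0 < h \<Longrightarrow> h < d \<Longrightarrow> g s > g (s + h)"
      using DERIV_neg_dec_right[OF g \<open>D < 0\<close>] by auto
    obtain d' where d': "0 < d'" "\<And>h. 0 < h \<Longrightarrow> h < d' \<Longrightarrow> g (s - h) > g s"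
      using DERIV_neg_dec_left[OF g \<open>D < 0\<close>] by auto
    have "\<forall>\<^sub>F t in at_left s. (0 < g t) = True"
      unfolding eventually_at_left_field
      using d'(1) d'(2)[of "s - t" for t] g0 by (intro exI[of _ "s - d'"]) force
    moreover have "\<forall>\<^sub>F t in at_right s. (0 < g t) = False"
      unfolding eventually_at_right_field
      using d(1) d(2)[of "t - s" for t] g0 by (intro exI[of _ "s + d"]) force
    ultimately show ?thesis by (intro exI[of _ True]) simp
  qed
  then obtain P where "\<forall>\<^sub>F t in at_left s. (0 < g t) = P" "\<forall>\<^sub>F t in at_right s. (0 < g t) = (\<not> P)"
    by blast
  from this[unfolded g_def, THEN \<epsilon>_eventually_const]
  have "(\<epsilon> \<longlongrightarrow> (if P then n2\<^sup>2 else n1\<^sup>2)) (at_left s)" "(\<epsilon> \<longlongrightarrow> (if \<not> P then n2\<^sup>2 else n1\<^sup>2)) (at_right s)"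
    by (auto intro: tendsto_eventually)
  moreover have "(if P then n2\<^sup>2 else n1\<^sup>2) \<noteq> (if \<not> P then n2\<^sup>2 else n1\<^sup>2)"
    using squares by auto
  ultimately show ?thesis unfolding switch_points_def by blast
qed

lemma not_switch_if_const_near:
  assumes "\<forall>\<^sub>F t in at s. \<epsilon> t = l"
  shows "s \<notin> switch_points \<epsilon>"
proof -
  have lr: "(\<epsilon> \<longlongrightarrow> l) (at_left s)" "(\<epsilon> \<longlongrightarrow> l) (at_right s)"
    using assms by (auto simp: eventually_at_split intro: tendsto_eventually)
  have "l' = l" if "(\<epsilon> \<longlongrightarrow> l') (at_left s)" for l'
    by (rule tendsto_unique[OF trivial_limit_at_left_real that lr(1)])
  moreover have "r' = l" if "(\<epsilon> \<longlongrightarrow> r') (at_right s)" for r'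
    by (rule tendsto_unique[OF trivial_limit_at_right_real that lr(2)])
  ultimately show ?thesis unfolding switch_points_def by blast
qed

lemma \<epsilon>_const_near_or_transversal:
  "(\<exists>l\<in>{n1\<^sup>2, n2\<^sup>2}. \<forall>\<^sub>F t in at s. \<epsilon> t = l) \<or> (Im ((y s)\<^sup>2) = 0 \<and> y s \<noteq> 0 \<and> p s \<noteq> 0)"
  using \<epsilon>_const_near_nonreal \<epsilon>_const_near_zero \<epsilon>_const_near_critical by blast

text \<open>
  Switching happens exactly where \<open>y\<^sup>2\<close> crosses the real axis transversally; at the other points
  with real \<open>y\<^sup>2\<close>, the zeros of \<open>y\<close> and of \<open>p\<close>, the axis is only touched.
\<close>

lemma switch_points_iff:
  "s \<in> switch_points \<epsilon> \<longleftrightarrow> Im ((y s)\<^sup>2) = 0 \<and> y s \<noteq> 0 \<and> p s \<noteq> 0"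
  using \<epsilon>_const_near_or_transversal[of s] switch_at_transversal_crossing not_switch_if_const_near by blast

lemma \<epsilon>_const_near_nonswitch:
  assumes "s \<notin> switch_points \<epsilon>"
  shows "\<exists>l\<in>{n1\<^sup>2, n2\<^sup>2}. \<forall>\<^sub>F t in at s. \<epsilon> t = l"
  using \<epsilon>_const_near_or_transversal assms switch_points_iff by blast

end

section \<open>The two waves in a layer\<close>

lemma exponential_solution:
  fixes f :: "real \<Rightarrow> complex"
  assumes cont: "continuous_on {a..b} f"
    and deriv: "\<And>s. s \<in> {a<..<b} \<Longrightarrow> (f has_vector_derivative c * f s) (at s)"
    and st: "s \<in> {a..b}" "t \<in> {a..b}"
  shows "f s = f t * exp (c * of_real (s - t))"
proof -
  define g where "g s = f s * exp (- c * of_real s)" for s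
  have const: "g s = g a" if "s \<in> {a..b}" for s
  proof (rule has_derivative_zero_unique_strong_interval[of "{a, b}" a b g "g a" s])
    show "continuous_on {a..b} g"
      unfolding g_def by (intro continuous_intros cont)
    fix r assume "r \<in> {a..b} - {a, b}"
    then have r: "r \<in> {a<..<b}" by auto
    have "((\<lambda>s. exp (- c * of_real s)) has_vector_derivative (- c * exp (- c * of_real r))) (at r)"
      by (rule has_vector_derivative_real_field) (auto intro!: derivative_eq_intros)
    from has_vector_derivative_mult[OF deriv[OF r] this]
    have "(g has_vector_derivative 0) (at r)"
      unfolding g_def by (simp add: algebra_simps)
    then show "(g has_derivative (\<lambda>h. 0)) (at r within {a..b})"
      by (auto simp: has_vector_derivative_def intro: has_derivative_at_withinI)
  qed (use that in auto)
  have "f s * exp (- c * of_real s) = f t * exp (- c * of_real t)"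
    using const[OF st(1)] const[OF st(2)] by (simp add: g_def)
  then have "f s * (exp (- c * of_real s) * exp (c * of_real s)) = f t * (exp (- c * of_real t) * exp (c * of_real s))"
    by (simp only: mult.assoc[symmetric])
  moreover have "exp (- c * of_real t) * exp (c * of_real s) = exp (c * of_real (s - t))"
    by (simp add: exp_add[symmetric] algebra_simps)
  moreover have "exp (- c * of_real s) * exp (c * of_real s) = 1"
    by (simp add: exp_minus)
  ultimately show ?thesis by (simp only: mult_1_right)
qed

locale abnormal_layer = abnormal_solution +
  fixes a b e :: real
  assumes a_less_b: "a < b"
    and switch_ends: "a \<in> switch_points \<epsilon>" "b \<in> switch_points \<epsilon>"
    and no_interior_switch: "\<And>s. s \<in> {a<..<b} \<Longrightarrow> s \<notin> switch_points \<epsilon>"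
    and right_limit: "(\<epsilon> \<longlongrightarrow> e) (at_right a)"
begin

text \<open>
  The value that \<open>\<epsilon>\<close> takes on punctured neighbourhoods is locally constant in the layer, hence
  constant, and it agrees with the right limit at the left end.
\<close>

lemma \<epsilon>_const_in_layer:
  shows "e \<in> {n1\<^sup>2, n2\<^sup>2}" and "s \<in> {a<..<b} \<Longrightarrow> \<forall>\<^sub>F t in at s. \<epsilon> t = e"
proof -
  obtain l where l: "\<And>s. s \<in> {a<..<b} \<Longrightarrow> l s \<in> {n1\<^sup>2, n2\<^sup>2} \<and> (\<forall>\<^sub>F t in at s. \<epsilon> t = l s)"
    using \<epsilon>_const_near_nonswitch[OF no_interior_switch] by metis
  have l_unique: "l s = r" if "s \<in> {a<..<b}" "\<forall>\<^sub>F t in at s. \<epsilon> t = r" for s r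
  proof -
    have "\<forall>\<^sub>F t in at s. l s = r"
      using that(2) l[OF that(1), THEN conjunct2] by eventually_elim simp
    then show ?thesis by (simp add: trivial_limit_at)
  qed
  have locally_const: "\<forall>\<^sub>F t in at s within {a<..<b}. l s = l t" if s: "s \<in> {a<..<b}" for s
  proof -
    obtain U where U: "open U" "s \<in> U" "\<And>t. t \<in> U \<Longrightarrow> t \<noteq> s \<Longrightarrow> \<epsilon> t = l s"
      using l[OF s] unfolding eventually_at_topological by blast
    have "l s = l t" if t: "t \<in> U" "t \<noteq> s" "t \<in> {a<..<b}" for t
    proof (rule l_unique[OF t(3), symmetric])
      show "\<forall>\<^sub>F r in at t. \<epsilon> r = l s"
        unfolding eventually_at_topological
        using U t by (intro exI[of _ "U - {s}"]) (auto intro: open_delete)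
    qed
    then show ?thesis unfolding eventually_at_topological using U(1,2) by blast
  qed
  have const: "l s = l t" if "s \<in> {a<..<b}" "t \<in> {a<..<b}" for s t
    by (rule connected_local_const[of "{a<..<b}" s t l]) (use that locally_const in auto)
  define m where "m = (a + b) / 2"
  have m: "m \<in> {a<..<b}" using a_less_b by (auto simp: m_def)
  have "l m = e"
  proof (rule ccontr)
    assume "l m \<noteq> e"
    then have "\<forall>\<^sub>F t in at_right a. \<epsilon> t \<noteq> l m"
      using tendsto_imp_eventually_ne[OF right_limit] by metis
    then obtain c where c: "a < c" "\<And>t. a < t \<Longrightarrow> t < c \<Longrightarrow> \<epsilon> t \<noteq> l m"
      unfolding eventually_at_right_field by blast
    define t where "t = (a + min b c) / 2"
    have t: "t \<in> {a<..<b}" "t < c" using c(1) a_less_b by (auto simp: t_def)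
    have "\<forall>\<^sub>F r in at t. r \<in> {a<..<c}"
      using t by (intro eventually_at_in_open') auto
    moreover have "\<forall>\<^sub>F r in at t. \<epsilon> r = l m" using l[OF t(1)] const[OF t(1) m] by simp
    ultimately have "\<forall>\<^sub>F r in at t. False" by eventually_elim (use c in auto)
    then show False by (simp add: trivial_limit_at)
  qed
  then show "e \<in> {n1\<^sup>2, n2\<^sup>2}" "s \<in> {a<..<b} \<Longrightarrow> \<forall>\<^sub>F t in at s. \<epsilon> t = e"
    using l[OF m] l[of s] const[of s m] m by auto
qed

lemma e_pos: "0 < e"
  using \<epsilon>_const_in_layer(1) squares by auto

definition r :: real where "r = sqrt e"

lemma r_pos: "0 < r" and r_square: "r * r = e"
  using e_pos by (auto simp: r_def)

text \<open>
  The equation holds classically at every interior point: a single exceptional value of \<open>\<epsilon>\<close> at \<open>s\<close>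
  itself does not affect the integrals of \<open>\<epsilon>\<close> over small intervals that end at \<open>s\<close>.
\<close>

lemma p_deriv:
  assumes s: "s \<in> {a<..<b}"
  shows "(p has_vector_derivative - (\<kappa> * e * y s)) (at s)"
  unfolding has_vector_derivative_def has_derivative_at_alt
proof (intro conjI allI impI)
  show "bounded_linear (\<lambda>h. h *\<^sub>R - (\<kappa> * e * y s))" by (rule bounded_linear_scaleR_left)
  fix \<delta> :: real assume "0 < \<delta>"
  define K where "K = norm \<kappa> * n2\<^sup>2"
  have K: "0 < K" using squares \<kappa>_nonzero unfolding K_def by (intro mult_pos_pos) auto
  have "0 < \<delta> / K" using \<open>0 < \<delta>\<close> K by simp
  then obtain d1 where d1: "0 < d1" "\<And>t. dist t s < d1 \<Longrightarrow> dist (y t) (y s) < \<delta> / K"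
    using y_cont[of s] unfolding continuous_at_eps_delta by (metis dist_norm real_norm_def)
  obtain d2 where d2: "0 < d2" "\<And>t. t \<noteq> s \<Longrightarrow> dist t s < d2 \<Longrightarrow> \<epsilon> t = e"
    using \<epsilon>_const_in_layer(2)[OF s] unfolding eventually_at by auto
  have int: "integral {t..t'} \<epsilon> = e * (t' - t)" if "t \<le> t'" "s \<in> {t, t'}" "\<bar>t' - t\<bar> < d2" for t t'
  proof -
    have "integral {t..t'} \<epsilon> = integral {t..t'} (\<lambda>_. e)"
    proof (rule integral_spike[of "{s}"])
      show "e = \<epsilon> u" if "u \<in> {t..t'} - {s}" for u
        using d2(2)[of u] that \<open>s \<in> {t, t'}\<close> \<open>\<bar>t' - t\<bar> < d2\<close> by (auto simp: dist_real_def)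
    qed simp
    then show ?thesis using \<open>t \<le> t'\<close> by (simp add: mult.commute)
  qed
  show "\<exists>d>0. \<forall>t. norm (t - s) < d \<longrightarrow>
      norm (p t - p s - (t - s) *\<^sub>R - (\<kappa> * e * y s)) \<le> \<delta> * norm (t - s)"
  proof (intro exI[of _ "min d1 d2"] conjI allI impI)
    fix t assume t: "norm (t - s) < min d1 d2"
    have near: "norm (y u - y s) \<le> \<delta> / K" if "\<bar>u - s\<bar> \<le> \<bar>t - s\<bar>" for u
      using d1(2)[of u] that t by (auto simp: dist_norm)
    have K\<delta>: "norm \<kappa> * n2\<^sup>2 * (\<delta> / K) = \<delta>" using K by (simp flip: K_def)
    show "norm (p t - p s - (t - s) *\<^sub>R - (\<kappa> * e * y s)) \<le> \<delta> * norm (t - s)"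
    proof (cases t s rule: linorder_cases)
      case less
      have "norm (p s - p t + \<kappa> * y s * integral {t..s} \<epsilon>) \<le> norm \<kappa> * n2\<^sup>2 * (\<delta> / K) * (s - t)"
        using less by (intro p_increment near) auto
      moreover have "p s - p t + \<kappa> * y s * integral {t..s} \<epsilon> = - (p t - p s - (t - s) *\<^sub>R - (\<kappa> * e * y s))"
      proof -
        have "integral {t..s} \<epsilon> = e * (s - t)" using less t int[of t s] by simp
        then show ?thesis by (simp only:) (simp add: scaleR_conv_of_real algebra_simps)
      qed
      moreover have "norm (t - s) = s - t" using less by simp
      ultimately show ?thesis by (simp only: norm_minus_cancel K\<delta>)
    next
      case greater
      have "norm (p t - p s + \<kappa> * y s * integral {s..t} \<epsilon>) \<le> norm \<kappa> * n2\<^sup>2 * (\<delta> / K) * (t - s)"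
        using greater by (intro p_increment near) auto
      moreover have "p t - p s + \<kappa> * y s * integral {s..t} \<epsilon> = p t - p s - (t - s) *\<^sub>R - (\<kappa> * e * y s)"
      proof -
        have "integral {s..t} \<epsilon> = e * (t - s)" using greater t int[of s t] by simp
        then show ?thesis by (simp only:) (simp add: scaleR_conv_of_real algebra_simps)
      qed
      moreover have "norm (t - s) = t - s" using greater by simp
      ultimately show ?thesis by (simp only: K\<delta>)
    qed simp
  qed (use d1 d2 in simp)
qed

text \<open>
  The components of \<open>(y, p)\<close> along the eigenvectors of the constant-coefficient system in the layer.
\<close>

definition F :: "real \<Rightarrow> complex" where "F s = (y s + p s / (\<i> * r)) / 2"
definition H :: "real \<Rightarrow> complex" where "H s = (y s - p s / (\<i> * r)) / 2"

lemma y_waves: "y s = F s + H s"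
  by (simp add: F_def H_def field_simps)

lemma p_waves: "p s = \<i> * r * (F s - H s)"
  using r_pos by (simp add: F_def H_def field_simps)

lemma wave_transport:
  assumes "s \<in> {a..b}" "t \<in> {a..b}"
  shows "F s = F t * exp (\<i> * \<kappa> * r * of_real (s - t))"
    and "H s = H t * exp (- (\<i> * \<kappa> * r) * of_real (s - t))"
proof -
  have cont: "continuous_on {a..b} y" "continuous_on {a..b} p"
    using y_cont p_cont by (auto intro: continuous_at_imp_continuous_on)
  have r0: "complex_of_real r \<noteq> 0" and re: "complex_of_real e = r * r"
    using r_pos r_square by (auto simp flip: of_real_mult)
  have yd: "(y has_vector_derivative \<kappa> * p s) (at s)" for s using y_deriv[of s] by (simp add: dy_eq)
  have derF: "(F has_vector_derivative (\<i> * \<kappa> * r) * F s) (at s)" if "s \<in> {a<..<b}" for s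
  proof -
    have "(F has_vector_derivative (\<kappa> * p s + - (\<kappa> * e * y s) / (\<i> * r)) / 2) (at s)"
      unfolding F_def[abs_def] by (intro has_vector_derivative_divide has_vector_derivative_add yd p_deriv that)
    moreover have "(\<kappa> * p s + - (\<kappa> * e * y s) / (\<i> * r)) / 2 = (\<i> * \<kappa> * r) * F s"
      using r0 by (simp add: F_def re field_simps)
    ultimately show ?thesis by simp
  qed
  have "continuous_on {a..b} F"
    unfolding F_def[abs_def] by (intro continuous_intros cont) (use r0 in simp_all)
  from exponential_solution[OF this derF assms]
  show "F s = F t * exp (\<i> * \<kappa> * r * of_real (s - t))"
    .
  have derH: "(H has_vector_derivative (- (\<i> * \<kappa> * r)) * H s) (at s)" if "s \<in> {a<..<b}" for s
  proof -
    have "(H has_vector_derivative (\<kappa> * p s - - (\<kappa> * e * y s) / (\<i> * r)) / 2) (at s)"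
      unfolding H_def[abs_def] by (intro has_vector_derivative_divide has_vector_derivative_diff yd p_deriv that)
    moreover have "(\<kappa> * p s - - (\<kappa> * e * y s) / (\<i> * r)) / 2 = (- (\<i> * \<kappa> * r)) * H s"
      using r0 by (simp add: H_def re field_simps)
    ultimately show ?thesis by simp
  qed
  have "continuous_on {a..b} H"
    unfolding H_def[abs_def] by (intro continuous_intros cont) (use r0 in simp_all)
  from exponential_solution[OF this derH assms]
  show "H s = H t * exp ((- (\<i> * \<kappa> * r)) * of_real (s - t))"
    .
qed

end

section \<open>Length of a layer and transport of the logarithmic derivative\<close>

lemma Re_quotient_eq_0:
  assumes "norm z = norm w"
  shows "Re ((z - w) / (z + w)) = 0"
proof -
  have "(norm z)\<^sup>2 = (norm w)\<^sup>2" using assms by simp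
  then have "Re (z - w) * Re (z + w) + Im (z - w) * Im (z + w) = 0"
    unfolding cmod_power2 by (simp add: algebra_simps power2_eq_square)
  then show ?thesis by (simp only: Re_divide div_0)
qed

context abnormal_layer
begin

definition q :: real where "q = - Im \<kappa> / Re \<kappa>"

lemma q_pos: "0 < q"
  using Re_\<kappa> Im_\<kappa> by (simp add: q_def divide_neg_pos)

text \<open>
  The angle by which the wave \<open>F\<close> turns over a distance \<open>d\<close>; meanwhile its modulus grows by the
  factor \<open>exp (q * phase d)\<close>, as \<open>exponent_eq\<close> says.
\<close>

definition phase :: "real \<Rightarrow> real" where "phase d = Re \<kappa> * r * d"

text \<open>
  The distance of a quarter turn of \<open>F\<close>, and so of half a turn of \<open>F\<^sup>2\<close>.
\<close>

definition quarter :: real where "quarter = pi / (2 * r * Re \<kappa>)"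

lemma quarter_pos: "0 < quarter"
  using r_pos Re_\<kappa> by (simp add: quarter_def)

lemma phase_quarter: "phase quarter = pi / 2" "phase (- quarter) = - (pi / 2)"
  using r_pos Re_\<kappa> by (simp_all add: phase_def quarter_def)

lemma phase_mono: "phase d < phase d' \<longleftrightarrow> d < d'"
  using r_pos Re_\<kappa> by (simp add: phase_def)

lemma phase_0: "phase 0 = 0"
  by (simp add: phase_def)

lemma exponent_eq: "\<i> * \<kappa> * r * of_real d = Complex (q * phase d) (phase d)"
  using Re_\<kappa> by (simp add: complex_eq_iff q_def phase_def)

lemma wave_norms:
  assumes "s \<in> {a..b}" "t \<in> {a..b}"
  shows "norm (F s) = norm (F t) * exp (q * phase (s - t))"
    and "norm (H s) = norm (H t) * exp (- (q * phase (s - t)))"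
  using wave_transport[OF assms] exponent_eq[of "s - t"]
  by (simp_all add: norm_mult norm_exp_eq_Re)

text \<open>
  The complex quantity \<open>e y\<^sup>2 + p\<^sup>2 = 4 e F H\<close> is conserved in the layer, and at its left end both
  squares are real.
\<close>

lemma Im_FH:
  assumes "s \<in> {a..b}"
  shows "Im (F s * H s) = 0"
proof -
  have "F s * H s = F a * H a"
  proof -
    have "F s * H s = F a * H a * (exp (\<i> * \<kappa> * r * of_real (s - a)) * exp (- (\<i> * \<kappa> * r) * of_real (s - a)))"
      using wave_transport[OF assms, of a] a_less_b by simp
    also have "exp (\<i> * \<kappa> * r * of_real (s - a)) * exp (- (\<i> * \<kappa> * r) * of_real (s - a)) = 1"
      by (simp add: exp_minus)
    finally show ?thesis by simp
  qed
  moreover have "F a * H a = ((y a)\<^sup>2 + (p a)\<^sup>2 / of_real (r * r)) / 4"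
    using r_pos by (simp add: F_def H_def field_simps power2_eq_square)
  moreover have "Im ((y a)\<^sup>2) = 0" "Im ((p a)\<^sup>2) = 0"
    using switch_ends(1) Im_p_square_0_iff[of a] by (auto simp: switch_points_iff)
  ultimately show ?thesis by (simp only: Im_divide_of_real Im_divide_numeral plus_complex.simps) simp
qed

text \<open>
  The central formula.  Since \<open>F H\<close> is real, only \<open>F\<^sup>2 + H\<^sup>2\<close> contributes to \<open>Im (y\<^sup>2)\<close>.  Measured
  from a point where both squares are real, the two contributions turn in opposite directions at
  equal speed, so they share the sine up to sign and otherwise differ by their moduli only.
\<close>

lemma Im_y_square:
  assumes s: "s \<in> {a..b}" and t: "t \<in> {a..b}" and real: "Im ((F t)\<^sup>2) = 0" "Im ((H t)\<^sup>2) = 0"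
  shows "Im ((y s)\<^sup>2) = sin (2 * phase (s - t)) *
    (Re ((F t)\<^sup>2) * exp (2 * (q * phase (s - t))) - Re ((H t)\<^sup>2) * exp (- (2 * (q * phase (s - t)))))"
proof -
  let ?z = "Complex (q * phase (s - t)) (phase (s - t))"
  have E: "(exp ?z)\<^sup>2 = exp (Complex (2 * (q * phase (s - t))) (2 * phase (s - t)))"
    "(exp (- ?z))\<^sup>2 = exp (Complex (- (2 * (q * phase (s - t)))) (- (2 * phase (s - t))))"
    unfolding exp_double[symmetric] by (rule arg_cong[where f=exp], simp add: complex_eq_iff)+
  have "(F s)\<^sup>2 = (F t)\<^sup>2 * (exp ?z)\<^sup>2"
    using wave_transport(1)[OF s t] by (simp only: exponent_eq power_mult_distrib)
  then have FF: "Im ((F s)\<^sup>2) = Re ((F t)\<^sup>2) * (exp (2 * (q * phase (s - t))) * sin (2 * phase (s - t)))"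
    using real(1) by (simp only: E times_complex.simps Im_exp Re_exp complex.sel mult_zero_left add_0_right)
  have "(H s)\<^sup>2 = (H t)\<^sup>2 * (exp (- ?z))\<^sup>2"
    using wave_transport(2)[OF s t] by (simp only: exponent_eq power_mult_distrib mult_minus_left)
  then have HH: "Im ((H s)\<^sup>2) = - Re ((H t)\<^sup>2) * (exp (- (2 * (q * phase (s - t)))) * sin (2 * phase (s - t)))"
    using real(2) by (simp only: E times_complex.simps Im_exp complex.sel) simp
  have "(y s)\<^sup>2 = (F s)\<^sup>2 + (H s)\<^sup>2 + (F s * H s + F s * H s)"
    by (simp add: y_waves power2_eq_square algebra_simps)
  then have "Im ((y s)\<^sup>2) = Im ((F s)\<^sup>2) + Im ((H s)\<^sup>2)"
    using Im_FH[OF s] by (simp only: plus_complex.simps add_0_right)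
  then show ?thesis unfolding FF HH by (simp add: algebra_simps)
qed

lemma interior_zero_degenerate:
  assumes "s \<in> {a<..<b}" "Im ((y s)\<^sup>2) = 0"
  shows "y s = 0 \<or> p s = 0"
  using no_interior_switch[OF assms(1)] assms(2) switch_points_iff by blast

lemma ends: "Im ((y a)\<^sup>2) = 0" "y a \<noteq> 0" "p a \<noteq> 0" "Im ((y b)\<^sup>2) = 0" "y b \<noteq> 0" "p b \<noteq> 0"
  using switch_ends by (auto simp: switch_points_iff)

lemma equal_norms_imp_imaginary:
  assumes "norm (F s) = norm (H s)"
  shows "Re (p s / (\<i> * y s)) = 0"
proof -
  have "p s / (\<i> * y s) = of_real r * ((F s - H s) / (F s + H s))"
    by (simp add: p_waves y_waves)
  then show ?thesis using Re_quotient_eq_0[OF assms] by (simp only: times_complex.simps) simp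
qed

text \<open>
  The logarithmic derivative avoids the imaginary circle, so the moduli of \<open>F\<close> and \<open>H\<close> never agree
  and the second factor in \<open>Im_y_square\<close> has no zero.  Moreover \<open>Im (F\<^sup>2)\<close> times the difference of
  the squared moduli is a multiple of \<open>Im (y\<^sup>2)\<close>, so \<open>F\<^sup>2\<close> and \<open>H\<^sup>2\<close> are real at the left end, and the
  formula can be centred there: the next crossing comes with the next zero of the sine.
\<close>

lemma full_quarter:
  assumes off: "\<And>s. s \<in> {a..b} \<Longrightarrow> y s \<noteq> 0 \<and> Re (p s / (\<i> * y s)) \<noteq> 0"
  shows "b - a = quarter"
proof -
  have ne: "norm (F s) \<noteq> norm (H s)" if "s \<in> {a..b}" for s
    using off[OF that] equal_norms_imp_imaginary by blast
  have ab: "a \<in> {a..b}" "b \<in> {a..b}" using a_less_b by auto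
  have FHa: "Im ((F a)\<^sup>2) = 0 \<and> Im ((H a)\<^sup>2) = 0"
  proof -
    define f1 f2 h1 h2 where "f1 = Re (F a)" and "f2 = Im (F a)" and "h1 = Re (H a)" and "h2 = Im (H a)"
    note d = f1_def[symmetric] f2_def[symmetric] h1_def[symmetric] h2_def[symmetric]
    \<comment> \<open>in real coordinates: reality of \<open>F H\<close> and of \<open>y\<^sup>2\<close>\<close>
    have e1: "f1 * h2 + f2 * h1 = 0" using Im_FH[OF ab(1)] by (simp add: d)
    have e2: "f1 * f2 + h1 * h2 = 0"
      using ends(1) e1 by (simp add: y_waves power2_eq_square d algebra_simps)
    have "f1 * f2 * (f1\<^sup>2 + f2\<^sup>2 - (h1\<^sup>2 + h2\<^sup>2)) = 0" using e1 e2 by algebra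
    moreover have "f1\<^sup>2 + f2\<^sup>2 \<noteq> h1\<^sup>2 + h2\<^sup>2"
    proof
      assume "f1\<^sup>2 + f2\<^sup>2 = h1\<^sup>2 + h2\<^sup>2"
      then have "(norm (F a))\<^sup>2 = (norm (H a))\<^sup>2" by (simp add: cmod_power2 d)
      then show False using ne[OF ab(1)] by simp
    qed
    ultimately have "f1 * f2 = 0" by simp
    moreover from this e2 have "h1 * h2 = 0" by (simp only: add_0_left)
    ultimately show ?thesis by (simp add: power2_eq_square d)
  qed
  have factor: "Re ((F a)\<^sup>2) * exp (2 * (q * phase (s - a))) - Re ((H a)\<^sup>2) * exp (- (2 * (q * phase (s - a)))) \<noteq> 0"
    if s: "s \<in> {a..b}" for s
  proof
    assume eq: "Re ((F a)\<^sup>2) * exp (2 * (q * phase (s - a))) - Re ((H a)\<^sup>2) * exp (- (2 * (q * phase (s - a)))) = 0"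
    have "\<bar>Re (z\<^sup>2)\<bar> = (norm z)\<^sup>2" if "Im (z\<^sup>2) = 0" for z
      using that by (metis norm_power complex_is_Real_iff in_Reals_norm)
    then have n: "\<bar>Re ((F a)\<^sup>2)\<bar> = (norm (F a))\<^sup>2" "\<bar>Re ((H a)\<^sup>2)\<bar> = (norm (H a))\<^sup>2" using FHa by auto
    have "\<bar>Re ((F a)\<^sup>2)\<bar> * exp (2 * (q * phase (s - a))) = \<bar>Re ((H a)\<^sup>2)\<bar> * exp (- (2 * (q * phase (s - a))))"
      using arg_cong[where f=abs, of "Re ((F a)\<^sup>2) * exp (2 * (q * phase (s - a)))" "Re ((H a)\<^sup>2) * exp (- (2 * (q * phase (s - a))))"] eq
      by (simp add: abs_mult)
    then have "(norm (F s))\<^sup>2 = (norm (H s))\<^sup>2"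
      unfolding wave_norms[OF s ab(1)] power_mult_distrib n exp_double[symmetric] by simp
    then show False using ne[OF s] by simp
  qed
  have "\<not> b - a < quarter"
  proof
    assume "b - a < quarter"
    then have "0 < phase (b - a)" "phase (b - a) < pi / 2"
      using phase_mono[of 0 "b - a"] phase_mono[of "b - a" quarter] a_less_b phase_quarter phase_0 by auto
    then have "0 < sin (2 * phase (b - a))" by (intro sin_gt_zero) auto
    then show False
      using Im_y_square[OF ab(2,1)] FHa factor[OF ab(2)] ends(4) by simp
  qed
  moreover have "\<not> quarter < b - a"
  proof
    assume *: "quarter < b - a"
    define s where "s = a + quarter"
    have s: "s \<in> {a<..<b}" using * quarter_pos by (auto simp: s_def)
    have "Im ((y s)\<^sup>2) = 0"
      using Im_y_square[of s a] s ab FHa phase_quarter by (simp add: s_def)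
    from interior_zero_degenerate[OF s this] show False using off[of s] s by auto
  qed
  ultimately show ?thesis by linarith
qed

text \<open>
  The logarithmic derivative depends on the quotient of the waves only, which \<open>W\<close> transports
  from \<open>t\<close> to \<open>s\<close>.
\<close>

lemma ratio_transport:
  assumes s: "s \<in> {a..b}" and t: "t \<in> {a..b}" and "y s \<noteq> 0"
  defines "W \<equiv> exp (2 * (\<i> * \<kappa> * r * of_real (s - t)))"
  shows "F t * W + H t \<noteq> 0" and "p s / (\<i> * y s) = r * ((F t * W - H t) / (F t * W + H t))"
proof -
  define E where "E = exp (\<i> * \<kappa> * r * of_real (s - t))"
  have E: "E \<noteq> 0" "W = E * E" by (simp_all add: E_def W_def exp_double power2_eq_square)
  have FH: "F s * E = F t * W" "H s * E = H t"
    using wave_transport[OF s t] E by (simp_all add: E_def exp_minus)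
  have sum: "F t * W + H t = y s * E"
    by (simp only: y_waves distrib_right FH)
  have diff: "F t * W - H t = (F s - H s) * E"
    by (simp only: left_diff_distrib FH)
  show "F t * W + H t \<noteq> 0"
    unfolding sum using \<open>y s \<noteq> 0\<close> E(1) by simp
  show "p s / (\<i> * y s) = r * ((F t * W - H t) / (F t * W + H t))"
    unfolding sum diff p_waves using E(1) by simp
qed

definition Q :: real where "Q = exp (q * pi)"

lemma Q_gt_1: "1 < Q"
  using q_pos by (simp add: Q_def)

lemma exp_quarter:
  "exp (2 * (\<i> * \<kappa> * r * of_real quarter)) = - of_real Q"
  "exp (2 * (\<i> * \<kappa> * r * of_real (- quarter))) = - of_real (1 / Q)"
proof -
  have "2 * Complex u v = Complex (2 * u) (2 * v)" for u v by (simp add: complex_eq_iff)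
  then show "exp (2 * (\<i> * \<kappa> * r * of_real quarter)) = - of_real Q"
    "exp (2 * (\<i> * \<kappa> * r * of_real (- quarter))) = - of_real (1 / Q)"
    unfolding exponent_eq phase_quarter
    by (simp_all add: complex_eq_iff Re_exp Im_exp Q_def exp_minus inverse_eq_divide)
qed

lemma q1_eq: "q1_of \<kappa> = (Q + 1) / (Q - 1)"
proof -
  have "exp (- q_of \<kappa> * pi) = 1 / Q"
    by (simp add: q_of_def Q_def q_def exp_minus inverse_eq_divide)
  then show ?thesis unfolding q1_of_def using Q_gt_1 by (simp only:) (simp add: field_simps)
qed

text \<open>
  After a quarter turn \<open>F / H\<close> has been multiplied by \<open>- Q\<close>.  In the coordinate
  \<open>r (F - H) / (F + H)\<close>, this multiplication is the Moebius map of the layer matrix.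
\<close>

lemma ratio_after_quarter:
  assumes "b - a = quarter"
  shows "moebius_map (layer_matrix \<kappa> e) (Fin (p a / (\<i> * y a))) = Fin (p b / (\<i> * y b))"
proof -
  have ab: "a \<in> {a..b}" "b \<in> {a..b}" using a_less_b by auto
  have Qc: "complex_of_real Q - 1 \<noteq> 0"
    using Q_gt_1 by (metis of_real_1 of_real_diff of_real_eq_0_iff diff_gt_0_iff_gt less_irrefl)
  have r0: "complex_of_real r \<noteq> 0" using r_pos by simp
  have ya: "F a + H a \<noteq> 0" using ends(2) y_waves by simp
  have denb: "F a * Q - H a \<noteq> 0"
    using ratio_transport(1)[OF ab(2,1) ends(5)] unfolding assms exp_quarter by (auto simp: algebra_simps)
  have xa: "p a / (\<i> * y a) = r * ((F a - H a) / (F a + H a))"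
    by (simp add: p_waves y_waves)
  have xb: "p b / (\<i> * y b) = r * ((F a * Q + H a) / (F a * Q - H a))"
  proof -
    have "(F a * - of_real Q - H a) / (F a * - of_real Q + H a) = (- (F a * Q + H a)) / (- (F a * Q - H a))"
      by (simp add: algebra_simps)
    also have "\<dots> = (F a * Q + H a) / (F a * Q - H a)" by (rule minus_divide_divide)
    finally show ?thesis
      using ratio_transport(2)[OF ab(2,1) ends(5)] unfolding assms exp_quarter by (simp only:)
  qed
  have q1: "complex_of_real (q1_of \<kappa>) = (Q + 1) / (Q - 1)"
    by (simp add: q1_eq)
  have den: "of_real (q1_of \<kappa> / r) * (p a / (\<i> * y a)) + 1 = 2 * (F a * Q - H a) / ((Q - 1) * (F a + H a))"
  proof -
    have "of_real (q1_of \<kappa> / r) * (p a / (\<i> * y a)) = ((Q + 1) * (F a - H a)) / ((Q - 1) * (F a + H a))"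
      unfolding xa of_real_divide q1 using r0 by simp
    moreover have "(Q - 1) * (F a + H a) \<noteq> 0" using ya Qc by simp
    ultimately have "of_real (q1_of \<kappa> / r) * (p a / (\<i> * y a)) + 1
        = ((Q + 1) * (F a - H a) + (Q - 1) * (F a + H a)) / ((Q - 1) * (F a + H a))"
      by (simp only: add_divide_distrib divide_self not_False_eq_True)
    also have "(Q + 1) * (F a - H a) + (Q - 1) * (F a + H a) = 2 * (F a * Q - H a)"
      by (simp add: algebra_simps)
    finally show ?thesis .
  qed
  have num: "p a / (\<i> * y a) + of_real (r * q1_of \<kappa>) = 2 * r * (F a * Q + H a) / ((Q - 1) * (F a + H a))"
    unfolding xa using ya r0 Qc by (simp add: q1 field_simps)
  have "of_real (q1_of \<kappa> / r) * (p a / (\<i> * y a)) + 1 \<noteq> 0"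
    unfolding den using denb ya Qc by simp
  moreover have "(p a / (\<i> * y a) + of_real (r * q1_of \<kappa>)) / (of_real (q1_of \<kappa> / r) * (p a / (\<i> * y a)) + 1)
      = p b / (\<i> * y b)"
  proof -
    have "(2 * r * A / D) / (2 * B / D) = r * (A / B)" if "B \<noteq> 0" "D \<noteq> 0" for A B D :: complex
      using that by simp
    moreover have "(Q - 1) * (F a + H a) \<noteq> 0" using ya Qc by simp
    ultimately show ?thesis unfolding num den xb using denb by (simp only: not_False_eq_True)
  qed
  ultimately show ?thesis
    by (simp only: layer_matrix_def moebius_map.simps vector_2 r_def[symmetric] mult_1_left if_False)
qed

text \<open>
  The sign \<open>\<tau>\<close> is \<open>-1\<close> at a zero of \<open>y\<close> and \<open>1\<close> at a zero of \<open>p\<close>.  With \<open>H\<^sup>2 = F\<^sup>2\<close> at \<open>t\<close>, both factors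
  in \<open>Im_y_square\<close> vanish together at \<open>t\<close>, where the real axis is therefore touched and not crossed.
  The second factor has no other zero, so the crossings nearest to \<open>t\<close> are a quarter turn
  away on either side.
\<close>

lemma centred_layer:
  fixes \<tau> :: real
  assumes t: "t \<in> {a..b}" and \<tau>: "\<tau> = 1 \<or> \<tau> = -1" and H: "H t = \<tau> * F t"
  shows "b - t = quarter" "t - a = quarter"
    and "p b / (\<i> * y b) = of_real (r * ((Q + \<tau>) / (Q - \<tau>)))"
    and "p a / (\<i> * y a) = - of_real (r * ((Q + \<tau>) / (Q - \<tau>)))"
proof -
  have ab: "a \<in> {a..b}" "b \<in> {a..b}" using a_less_b by auto
  have "y t = 0 \<or> p t = 0" using \<tau> H by (auto simp: y_waves p_waves)
  then have "t \<noteq> a" "t \<noteq> b" using ends by auto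
  then have t': "a < t" "t < b" using t by auto
  have F0: "F t \<noteq> 0" using no_double_zero[of t] H by (auto simp: y_waves p_waves)
  have \<tau>2: "\<tau> * \<tau> = 1" using \<tau> by auto
  have HH: "(H t)\<^sup>2 = (F t)\<^sup>2"
  proof -
    have "(H t)\<^sup>2 = of_real (\<tau> * \<tau>) * (F t)\<^sup>2" by (simp add: H power2_eq_square mult_ac)
    then show ?thesis by (simp add: \<tau>2)
  qed
  have Im0: "Im ((F t)\<^sup>2) = 0"
  proof -
    have "F t * H t = of_real \<tau> * (F t)\<^sup>2" by (simp add: H power2_eq_square)
    then have "\<tau> * Im ((F t)\<^sup>2) = 0" using Im_FH[OF t] by (simp only: times_complex.simps) simp
    then show ?thesis using \<tau> by auto
  qed
  have Re0: "Re ((F t)\<^sup>2) \<noteq> 0"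
    using Im0 F0 complex_eq_iff[of "(F t)\<^sup>2" 0] by simp
  have Im_y: "Im ((y s)\<^sup>2) = sin (2 * phase (s - t)) *
      (Re ((F t)\<^sup>2) * (exp (2 * (q * phase (s - t))) - exp (- (2 * (q * phase (s - t))))))"
    if "s \<in> {a..b}" for s
    using Im_y_square[OF that t] Im0 by (simp add: HH right_diff_distrib)
  have exp_ne: "exp (2 * (q * phase d)) - exp (- (2 * (q * phase d))) \<noteq> 0" if "d \<noteq> 0" for d
    using that q_pos phase_mono[of d 0] phase_mono[of 0 d] phase_0 by auto
  have nondegenerate: "y s \<noteq> 0 \<and> p s \<noteq> 0" if "s \<in> {a..b}" "s \<noteq> t" for s
  proof -
    have "norm (H t) = norm (F t)" using \<tau> H by auto
    then have "norm (F s) \<noteq> norm (H s)"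
      unfolding wave_norms[OF that(1) t] using F0 that(2) q_pos phase_mono[of "s - t" 0] phase_mono[of 0 "s - t"] phase_0 by auto
    then have "F s \<noteq> H s" "F s \<noteq> - H s" by auto
    then show ?thesis using r_pos by (auto simp: y_waves p_waves eq_neg_iff_add_eq_0)
  qed
  \<comment> \<open>an end of the layer is a zero of \<open>Im (y\<^sup>2)\<close>, and the formula has none this close to \<open>t\<close>\<close>
  have short: False if "s \<in> {a, b}" "\<bar>s - t\<bar> < quarter" for s
  proof -
    have "s \<noteq> t" using that t' by auto
    have "phase (s - t) < pi / 2" "- (pi / 2) < phase (s - t)"
      using that(2) phase_mono[of "s - t" quarter] phase_mono[of "- quarter" "s - t"] phase_quarter by auto
    moreover have "phase (s - t) \<noteq> 0"
      using \<open>s \<noteq> t\<close> phase_mono[of "s - t" 0] phase_mono[of 0 "s - t"] phase_0 by auto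
    ultimately have "sin (2 * phase (s - t)) \<noteq> 0"
      using sin_gt_zero[of "2 * phase (s - t)"] sin_gt_zero[of "- (2 * phase (s - t))"]
      by (cases "0 < phase (s - t)") (auto simp del: sin_minus, auto)
    moreover have "s \<in> {a..b}" "Im ((y s)\<^sup>2) = 0" using that(1) ab ends by auto
    ultimately show False using Im_y[of s] Re0 exp_ne[of "s - t"] \<open>s \<noteq> t\<close> by simp
  qed
  \<comment> \<open>if an end were further away, a quarter turn from \<open>t\<close> would be an interior crossing\<close>
  have long: False if "s \<in> {a<..<b}" "s = t + quarter \<or> s = t - quarter" for s
  proof -
    have "2 * phase (s - t) = pi \<or> 2 * phase (s - t) = - pi" using that(2) phase_quarter by auto
    then have "sin (2 * phase (s - t)) = 0" by auto
    then have "Im ((y s)\<^sup>2) = 0" using Im_y[of s] that(1) by simp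
    then show False
      using interior_zero_degenerate[OF that(1)] nondegenerate[of s] that quarter_pos by auto
  qed
  show bt: "b - t = quarter"
    using short[of b] long[of "t + quarter"] t' quarter_pos by (cases "b - t" quarter rule: linorder_cases) auto
  show ta: "t - a = quarter"
    using short[of a] long[of "t - quarter"] t' quarter_pos by (cases "t - a" quarter rule: linorder_cases) auto
  have at: "a - t = - quarter" using ta by simp
  have Qr: "Q - \<tau> \<noteq> 0" "Q \<noteq> 0" using \<tau> Q_gt_1 by auto
  have "p b / (\<i> * y b) = r * ((F t * - of_real Q - \<tau> * F t) / (F t * - of_real Q + \<tau> * F t))"
    using ratio_transport(2)[OF ab(2) t ends(5)] unfolding bt exp_quarter H .
  also have "(F t * - of_real Q - \<tau> * F t) / (F t * - of_real Q + \<tau> * F t)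
      = (- F t * of_real (Q + \<tau>)) / (- F t * of_real (Q - \<tau>))"
    by (simp add: algebra_simps)
  also have "\<dots> = of_real ((Q + \<tau>) / (Q - \<tau>))" using F0 by simp
  finally show "p b / (\<i> * y b) = of_real (r * ((Q + \<tau>) / (Q - \<tau>)))" by simp
  have "p a / (\<i> * y a) = r * ((F t * - of_real (1 / Q) - \<tau> * F t) / (F t * - of_real (1 / Q) + \<tau> * F t))"
    using ratio_transport(2)[OF ab(1) t ends(2)] unfolding at exp_quarter H .
  also have "(F t * - of_real (1 / Q) - \<tau> * F t) / (F t * - of_real (1 / Q) + \<tau> * F t)
      = (F t * of_real (- (1 / Q) - \<tau>)) / (F t * of_real (- (1 / Q) + \<tau>))"
    by (simp add: algebra_simps)
  also have "\<dots> = of_real ((- (1 / Q) - \<tau>) / (- (1 / Q) + \<tau>))" using F0 by simp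
  also have "(- (1 / Q) - \<tau>) / (- (1 / Q) + \<tau>) = - ((Q + \<tau>) / (Q - \<tau>))"
  proof -
    have "- (1 / Q) - \<tau> = - (\<tau> * (Q + \<tau>)) / Q" "- (1 / Q) + \<tau> = (\<tau> * (Q - \<tau>)) / Q"
      using Qr(2) \<tau>2 by (simp_all add: field_simps)
    then show ?thesis using Qr \<tau> by auto
  qed
  finally show "p a / (\<i> * y a) = - of_real (r * ((Q + \<tau>) / (Q - \<tau>)))" by simp
qed

end

section \<open>Layers of abnormal extremals\<close>

theorem theorem6p5:
  fixes n1 n2 :: real and \<kappa> :: complex
    and x :: "real \<Rightarrow> csphere" and eps :: "real \<Rightarrow> real" and y :: "real \<Rightarrow> complex"
    and b :: "int \<Rightarrow> real" and j :: int and e :: real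
  assumes "0 < n1" and "n1 < n2"
    and "Re \<kappa> > 0" and "Im \<kappa> < 0"
    and "abnormal_extremal_tuple n1 n2 \<kappa> x eps 0 y"
    and "enumerates_switch_points eps b"
    and "(eps \<longlongrightarrow> e) (at_right (b j))"
  shows "q1_of \<kappa> > 1 \<and>
    (x ` {b j..b (j + 1)} \<inter> imaginary_circle = {} \<longrightarrow>
       b (j + 1) - b j = pi / (2 * sqrt e * Re \<kappa>) \<and>
       x (b (j + 1)) = moebius_map (layer_matrix \<kappa> e) (x (b j))) \<and>
    (\<forall>s0 \<in> {b j..b (j + 1)}. x s0 \<in> {Fin 0, Infty} \<longrightarrow>
       s0 = (b j + b (j + 1)) / 2 \<and>
       b (j + 1) - b j = pi / (sqrt e * Re \<kappa>) \<and>
       (x s0 = Infty \<longrightarrow>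
          (\<exists>t::real. 0 < t \<and> t < sqrt e \<and>
             x (b j) = Fin (- of_real t) \<and> x (b (j + 1)) = Fin (of_real t))) \<and>
       (x s0 = Fin 0 \<longrightarrow>
          (\<exists>t::real. sqrt e < t \<and>
             x (b j) = Fin (- of_real t) \<and> x (b (j + 1)) = Fin (of_real t))))"
proof -
  have tuple: "nontrivial_solution n1 n2 \<kappa> y" "eps = permittivity n1 n2 y"
    "\<And>s. x s = (if y s = 0 then Infty else Fin (dy y s / (\<i> * \<kappa> * y s)))"
    "\<And>s. Im (of_real (eps s) * (y s)\<^sup>2 + (dy y s)\<^sup>2 / \<kappa>\<^sup>2) = 0"
    using assms(5) by (auto simp: abnormal_extremal_tuple_def extended_extremal_tuple_def)
  have enum: "strict_mono b" "range b = switch_points (permittivity n1 n2 y)"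
    using assms(6) tuple(2) by (auto simp: enumerates_switch_points_def)
  interpret abnormal_solution n1 n2 \<kappa> y
    using assms(1-4) tuple by unfold_locales auto
  interpret abnormal_layer n1 n2 \<kappa> y "b j" "b (j + 1)" e
  proof unfold_locales
    show "b j < b (j + 1)" using enum(1) by (simp add: strict_mono_def)
    show "b j \<in> switch_points \<epsilon>" "b (j + 1) \<in> switch_points \<epsilon>" using enum(2) by auto
    show "(\<epsilon> \<longlongrightarrow> e) (at_right (b j))" using assms(7) tuple(2) by simp
    fix s assume s: "s \<in> {b j<..<b (j + 1)}"
    show "s \<notin> switch_points \<epsilon>"
    proof
      assume "s \<in> switch_points \<epsilon>"
      then obtain k where "s = b k" using enum(2) by blast
      then have "j < k" "k < j + 1" using s strict_mono_less[OF enum(1)] by auto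
      then show False by simp
    qed
  qed
  have x_eq: "x s = (if y s = 0 then Infty else Fin (p s / (\<i> * y s)))" for s
    using \<kappa>_nonzero by (simp add: tuple(3) p_def mult_ac)
  have q1: "1 < q1_of \<kappa>" using Q_gt_1 by (simp add: q1_eq)
  have double: "2 * quarter = pi / (sqrt e * Re \<kappa>)" by (simp add: quarter_def r_def)
  have part1: "b (j + 1) - b j = pi / (2 * sqrt e * Re \<kappa>) \<and> x (b (j + 1)) = moebius_map (layer_matrix \<kappa> e) (x (b j))"
    if "x ` {b j..b (j + 1)} \<inter> imaginary_circle = {}"
  proof -
    have "y s \<noteq> 0 \<and> Re (p s / (\<i> * y s)) \<noteq> 0" if "s \<in> {b j..b (j + 1)}" for s
    proof -
      have "x s \<notin> imaginary_circle" using that \<open>x ` _ \<inter> _ = {}\<close> by blast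
      then show ?thesis by (auto simp: x_eq imaginary_circle_def split: if_splits)
    qed
    then have "b (j + 1) - b j = quarter" by (rule full_quarter)
    then show ?thesis
      using ratio_after_quarter ends by (simp add: x_eq quarter_def r_def)
  qed
  have part2: "s0 = (b j + b (j + 1)) / 2 \<and> b (j + 1) - b j = pi / (sqrt e * Re \<kappa>) \<and>
       (x s0 = Infty \<longrightarrow> (\<exists>t::real. 0 < t \<and> t < sqrt e \<and>
             x (b j) = Fin (- of_real t) \<and> x (b (j + 1)) = Fin (of_real t))) \<and>
       (x s0 = Fin 0 \<longrightarrow> (\<exists>t::real. sqrt e < t \<and>
             x (b j) = Fin (- of_real t) \<and> x (b (j + 1)) = Fin (of_real t)))"
    if s0: "s0 \<in> {b j..b (j + 1)}" "x s0 \<in> {Fin 0, Infty}" for s0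
  proof -
    define \<tau> :: real where "\<tau> = (if y s0 = 0 then - 1 else 1)"
    have \<tau>: "\<tau> = 1 \<or> \<tau> = - 1" by (simp add: \<tau>_def)
    have "H s0 = \<tau> * F s0"
      using s0(2) by (auto simp: \<tau>_def x_eq F_def H_def split: if_splits)
    note centre = centred_layer[OF s0(1) \<tau> this]
    have mid: "s0 = (b j + b (j + 1)) / 2" "b (j + 1) - b j = pi / (sqrt e * Re \<kappa>)"
      unfolding double[symmetric] using centre(1,2) by auto
    define t where "t = r * ((Q + \<tau>) / (Q - \<tau>))"
    have x_ends: "x (b j) = Fin (- of_real t)" "x (b (j + 1)) = Fin (of_real t)"
      unfolding t_def using centre(3,4) ends by (simp_all add: x_eq)
    have inf: "0 < t \<and> t < sqrt e" if "x s0 = Infty"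
    proof -
      have "t = r * ((Q - 1) / (Q + 1))" using that by (auto simp: t_def \<tau>_def x_eq split: if_splits)
      moreover have "0 < (Q - 1) / (Q + 1)" "(Q - 1) / (Q + 1) < 1" using Q_gt_1 by auto
      ultimately show ?thesis
        using r_pos mult_strict_left_mono[of "(Q - 1) / (Q + 1)" 1 r] mult_pos_pos[of r "(Q - 1) / (Q + 1)"]
        unfolding r_def[symmetric] by (simp only: mult_1_right simp_thms)
    qed
    have zero: "sqrt e < t" if "x s0 = Fin 0"
    proof -
      have "t = r * ((Q + 1) / (Q - 1))" using that by (auto simp: t_def \<tau>_def x_eq split: if_splits)
      moreover have "1 < (Q + 1) / (Q - 1)" using Q_gt_1 by auto
      ultimately show ?thesis
        using r_pos mult_strict_left_mono[of 1 "(Q + 1) / (Q - 1)" r]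
        unfolding r_def[symmetric] by (simp only: mult_1_right)
    qed
    show ?thesis using mid x_ends inf zero by blast
  qed
  show ?thesis using q1 part1 part2 by blast
qed

end
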